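(* Let $K$ be a finite field, let $S=K[t_1,\ldots,t_s]$, let $X=\{P_1,\ldots,P_m\}$ be a subset of $K^s$ with $|X|=m\ge 2$, let $I=I(X)$ be its vanishing ideal, let $\prec$ be a graded monomial order on $S$, and let $F=\{f_1,\ldots,f_m\}$ be the set of standard indicator functions for $X$. For each $i$ let $\mathfrak{p}_i$ be the vanishing ideal of $P_i$. If $I$ is Gorenstein, then for all $i=1,\ldots,m$, $$\mathrm{v}_{\mathfrak{p}_i}(I)=\deg(f_i)=\mathrm{reg}(H_I^a)\quad\text{and}\quad \mathrm{in}_\prec(f_i)=\mathrm{in}_\prec(f_m).$$
   Context: $I(X)$ is the ideal of all polynomials vanishing on $X$. A graded monomial order compares monomials first by total degree; $\mathrm{in}_\prec(f)$ is the initial monomial of $f\ne0$. $\Delta_\prec(I)$ is the set of standard monomials of $S/I$ (monomials not in $\mathrm{in}_\prec(I)$), and $K\Delta_\prec(I)$ is its $K$-span. The $i$-th standard indicator function $f_i$ is the unique polynomial in $K\Delta_\prec(I)$ with $f_i(P_i)=1$ and $f_i(P_j)=0$ for $j\neq i$. With $S_{\le d}$ the polynomials of total degree at most $d$ and $I_{\le d}=I\cap S_{\le d}$, $H_I^a(d)=\dim_K(S_{\le d}/I_{\le d})$, and $\mathrm{reg}(H_I^a)$ is the least integer $\ell\ge 0$ with $H_I^a(d)=|X|$ for all $d\ge\ell$. The associated primes of $I$ are exactly $\mathfrak{p}_1,\ldots,\mathfrak{p}_m$. Put $\mathrm{v}_{\mathfrak{p}_i}(I)=\min\{d\ge 0: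 \exists\, 0\ne f\in S,\ \deg(f)=d,\ (I\colon f)=\mathfrak{p}_i\}$, where $(I\colon f)=\{g\in S: gf\in I\}$. Gorenstein convention: let $u$ be a new variable; for $f\in S$ of degree $e$ let $f^h=u^e f(t_1/u,\ldots,t_s/u)$, and let $I^h=(\{f^h: f\in I\})\subset S[u]$ ($S[u]$ with the standard grading). The vanishing ideal $I=I(X)$ is called Gorenstein if $S[u]/I^h$ is a Gorenstein graded ring, i.e. it is Cohen--Macaulay and the last Betti number in its minimal graded free resolution over $S[u]$ equals $1$. *)

theory Defs
  imports
    "HOL-Library.Poly_Mapping"
    "HOL-Library.Extended_Nat"
    "Jordan_Normal_Form.Matrix"
begin

text \<open>
  The polynomial ring over \<^typ>\<open>'k\<close> with one variable for each element of the finite type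
  \<^typ>\<open>'v\<close>. A monomial is its exponent vector, so multiplication of monomials is addition
  of exponents and the monomial 1 is \<open>0\<close>. Affine space is \<^typ>\<open>'v \<Rightarrow> 'k\<close>.
\<close>

type_synonym 'v monom = "'v \<Rightarrow>\<^sub>0 nat"
type_synonym ('v, 'k) mpoly = "'v monom \<Rightarrow>\<^sub>0 'k"

definition mdeg :: "'v::finite monom \<Rightarrow> nat" where
  "mdeg t = (\<Sum>v\<in>UNIV. Poly_Mapping.lookup t v)"

text \<open>The zero polynomial gets degree 0, so it belongs to \<open>polys_le d\<close> for every \<open>d\<close>.\<close>

definition tdeg :: "('v::finite, 'k::zero) mpoly \<Rightarrow> nat" where
  "tdeg f = (if f = 0 then 0 else Max (mdeg ` Poly_Mapping.keys f))"

definition eval_poly :: "('v::finite, 'k::comm_ring_1) mpoly \<Rightarrow> ('v \<Rightarrow> 'k) \<Rightarrow> 'k" where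
  "eval_poly f x =
    (\<Sum>t\<in>Poly_Mapping.keys f. Poly_Mapping.lookup f t * (\<Prod>v\<in>UNIV. x v ^ Poly_Mapping.lookup t v))"

definition vanishing_ideal :: "('v::finite \<Rightarrow> 'k::comm_ring_1) set \<Rightarrow> ('v, 'k) mpoly set" where
  "vanishing_ideal X = {f. \<forall>x\<in>X. eval_poly f x = 0}"

text \<open>Ideals of a commutative ring are its submodules under multiplication.\<close>

abbreviation ideal_gen :: "'r::comm_ring_1 set \<Rightarrow> 'r set" where
  "ideal_gen \<equiv> module.span (*)"

definition colon_ideal :: "'r::comm_ring_1 set \<Rightarrow> 'r \<Rightarrow> 'r set" where
  "colon_ideal I f = {g. g * f \<in> I}"

definition prime_ideal :: "'r::comm_ring_1 set \<Rightarrow> bool" where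
  "prime_ideal Q \<longleftrightarrow> module.subspace (*) Q \<and> 1 \<notin> Q \<and> (\<forall>a b. a * b \<in> Q \<longrightarrow> a \<in> Q \<or> b \<in> Q)"


subsection \<open>Monomial orders and standard indicator functions\<close>

definition monomial_order :: "('v monom \<Rightarrow> 'v monom \<Rightarrow> bool) \<Rightarrow> bool" where
  "monomial_order prec \<longleftrightarrow> irreflp prec \<and> transp prec \<and> totalp prec
    \<and> (\<forall>t. t \<noteq> 0 \<longrightarrow> prec 0 t)
    \<and> (\<forall>a b c. prec a b \<longrightarrow> prec (a + c) (b + c))"

definition graded_monomial_order :: "('v::finite monom \<Rightarrow> 'v monom \<Rightarrow> bool) \<Rightarrow> bool" where
  "graded_monomial_order prec \<longleftrightarrow> monomial_order prec \<and> (\<forall>a b. mdeg a < mdeg b \<longrightarrow> prec a b)"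

definition initial_monomial ::
    "('v monom \<Rightarrow> 'v monom \<Rightarrow> bool) \<Rightarrow> ('v, 'k::zero) mpoly \<Rightarrow> 'v monom" where
  "initial_monomial prec f =
    (THE t. t \<in> Poly_Mapping.keys f \<and> (\<forall>t'\<in>Poly_Mapping.keys f. t' \<noteq> t \<longrightarrow> prec t' t))"

definition initial_ideal ::
    "('v monom \<Rightarrow> 'v monom \<Rightarrow> bool) \<Rightarrow> ('v, 'k::comm_ring_1) mpoly set \<Rightarrow> ('v, 'k) mpoly set" where
  "initial_ideal prec I =
    ideal_gen {Poly_Mapping.single (initial_monomial prec f) 1 | f. f \<in> I \<and> f \<noteq> 0}"

definition standard_monomials ::
    "('v monom \<Rightarrow> 'v monom \<Rightarrow> bool) \<Rightarrow> ('v, 'k::comm_ring_1) mpoly set \<Rightarrow> 'v monom set" where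
  "standard_monomials prec I = {t. Poly_Mapping.single t 1 \<notin> initial_ideal prec I}"

definition scale :: "'k::comm_ring_1 \<Rightarrow> ('v, 'k) mpoly \<Rightarrow> ('v, 'k) mpoly" where
  "scale c f = Poly_Mapping.single 0 c * f"

definition standard_span ::
    "('v monom \<Rightarrow> 'v monom \<Rightarrow> bool) \<Rightarrow> ('v, 'k::comm_ring_1) mpoly set \<Rightarrow> ('v, 'k) mpoly set" where
  "standard_span prec I =
    module.span scale ((\<lambda>t. Poly_Mapping.single t 1) ` standard_monomials prec I)"

definition standard_indicator ::
    "('v::finite monom \<Rightarrow> 'v monom \<Rightarrow> bool) \<Rightarrow> ('v \<Rightarrow> 'k::field) set \<Rightarrow> ('v \<Rightarrow> 'k) \<Rightarrow> ('v, 'k) mpoly" where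
  "standard_indicator prec X p =
    (THE f. f \<in> standard_span prec (vanishing_ideal X) \<and> eval_poly f p = 1
      \<and> (\<forall>q\<in>X - {p}. eval_poly f q = 0))"


subsection \<open>Affine Hilbert function, regularity and v-numbers\<close>

text \<open>
  \<open>basis_mod V W B\<close>: for \<open>W \<subseteq> V\<close>, the elements of \<open>B\<close> represent (without repetition) a basis
  of the quotient space \<open>V / W\<close>.
\<close>

definition basis_mod ::
    "('v, 'k::field) mpoly set \<Rightarrow> ('v, 'k) mpoly set \<Rightarrow> ('v, 'k) mpoly set \<Rightarrow> bool" where
  "basis_mod V W B \<longleftrightarrow> B \<subseteq> V
    \<and> (\<forall>A c. finite A \<and> A \<subseteq> B \<and> (\<Sum>b\<in>A. scale (c b) b) \<in> W \<longrightarrow> (\<forall>b\<in>A. c b = 0))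
    \<and> (\<forall>f\<in>V. \<exists>g\<in>module.span scale B. f - g \<in> W)"

definition quotient_dim :: "('v, 'k::field) mpoly set \<Rightarrow> ('v, 'k) mpoly set \<Rightarrow> nat" where
  "quotient_dim V W = card (SOME B. basis_mod V W B)"

definition polys_le :: "nat \<Rightarrow> ('v::finite, 'k::zero) mpoly set" where
  "polys_le d = {f. tdeg f \<le> d}"

definition affine_hilbert :: "('v::finite, 'k::field) mpoly set \<Rightarrow> nat \<Rightarrow> nat" where
  "affine_hilbert I d = quotient_dim (polys_le d) (I \<inter> polys_le d)"

definition hilbert_reg :: "('v::finite \<Rightarrow> 'k::field) set \<Rightarrow> nat" where
  "hilbert_reg X = (LEAST l. \<forall>d\<ge>l. affine_hilbert (vanishing_ideal X) d = card X)"

definition v_number :: "('v::finite, 'k::field) mpoly set \<Rightarrow> ('v, 'k) mpoly set \<Rightarrow> nat" where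
  "v_number Q I = (LEAST d. \<exists>f. f \<noteq> 0 \<and> tdeg f = d \<and> colon_ideal I f = Q)"


subsection \<open>Homogenization\<close>

text \<open>The variables of \<open>S[u]\<close> are indexed by \<^typ>\<open>'v option\<close>, with \<open>None\<close> standing for \<open>u\<close>.\<close>

definition homogenize_monom :: "nat \<Rightarrow> 'v::finite monom \<Rightarrow> 'v option monom" where
  "homogenize_monom e t = Poly_Mapping.single None (e - mdeg t)
    + (\<Sum>v\<in>UNIV. Poly_Mapping.single (Some v) (Poly_Mapping.lookup t v))"

definition homogenize :: "('v::finite, 'k::comm_ring_1) mpoly \<Rightarrow> ('v option, 'k) mpoly" where
  "homogenize f = (\<Sum>t\<in>Poly_Mapping.keys f.
    Poly_Mapping.single (homogenize_monom (tdeg f) t) (Poly_Mapping.lookup f t))"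

definition homogenize_ideal ::
    "('v::finite, 'k::comm_ring_1) mpoly set \<Rightarrow> ('v option, 'k) mpoly set" where
  "homogenize_ideal I = ideal_gen (homogenize ` I)"


subsection \<open>Graded Cohen--Macaulay and Gorenstein quotients\<close>

text \<open>
  In this section \<open>J\<close> is a homogeneous ideal of a polynomial ring \<open>R\<close> with the standard grading,
  and the notions concern the graded ring \<open>R / J\<close>. The primes of \<open>R / J\<close> are the primes of \<open>R\<close>
  containing \<open>J\<close>.
\<close>

definition krull_dim_quotient :: "'r::comm_ring_1 set \<Rightarrow> enat" where
  "krull_dim_quotient J = Sup {enat n | n. \<exists>Q :: nat \<Rightarrow> 'r set.
    (\<forall>i\<le>n. prime_ideal (Q i) \<and> J \<subseteq> Q i) \<and> (\<forall>i<n. Q i \<subset> Q (Suc i))}"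

definition regular_sequence_on_quotient :: "'r::comm_ring_1 set \<Rightarrow> 'r list \<Rightarrow> bool" where
  "regular_sequence_on_quotient J xs \<longleftrightarrow>
    (\<forall>i<length xs. \<forall>g. xs ! i * g \<in> ideal_gen (J \<union> set (take i xs))
      \<longrightarrow> g \<in> ideal_gen (J \<union> set (take i xs)))
    \<and> 1 \<notin> ideal_gen (J \<union> set xs)"

definition irrelevant_ideal :: "('v, 'k::comm_ring_1) mpoly set" where
  "irrelevant_ideal = ideal_gen {Poly_Mapping.single (Poly_Mapping.single v 1) 1 | v. True}"

definition depth_quotient :: "('v, 'k::comm_ring_1) mpoly set \<Rightarrow> enat" where
  "depth_quotient J = Sup {enat (length xs) | xs.
    set xs \<subseteq> irrelevant_ideal \<and> regular_sequence_on_quotient J xs}"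

definition cohen_macaulay_quotient :: "('v, 'k::comm_ring_1) mpoly set \<Rightarrow> bool" where
  "cohen_macaulay_quotient J \<longleftrightarrow> depth_quotient J = krull_dim_quotient J"

text \<open>
  A minimal graded free resolution
  \<open>0 \<rightarrow> F p \<rightarrow> \<dots> \<rightarrow> F 1 \<rightarrow> F 0 = R \<rightarrow> R / J \<rightarrow> 0\<close> of length \<open>p\<close>, whose last map is the
  canonical projection. Here \<open>F i\<close> is the direct sum of the \<open>R(- a i j)\<close> for \<open>j < b i\<close>, so the
  \<open>b i\<close> are the Betti numbers, and \<open>M i\<close> is the matrix of \<open>F (i + 1) \<rightarrow> F i\<close>. That the maps
  preserve degrees means that the entry in row \<open>k\<close> and column \<open>j\<close> of \<open>M i\<close> is homogeneous of
  degree \<open>a (i + 1) j - a i k\<close>; minimality means that all entries lie in the irrelevant ideal.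
\<close>

definition minimal_graded_free_resolution ::
    "('v::finite, 'k::comm_ring_1) mpoly set \<Rightarrow> nat \<Rightarrow> (nat \<Rightarrow> nat) \<Rightarrow> (nat \<Rightarrow> nat \<Rightarrow> int)
      \<Rightarrow> (nat \<Rightarrow> ('v, 'k) mpoly mat) \<Rightarrow> bool" where
  "minimal_graded_free_resolution J p b a M \<longleftrightarrow>
    b 0 = 1 \<and> a 0 0 = 0 \<and> b p \<noteq> 0 \<and> (\<forall>i>p. b i = 0)
    \<and> (\<forall>i. M i \<in> carrier_mat (b i) (b (Suc i)))
    \<and> (\<forall>i. \<forall>k<b i. \<forall>j<b (Suc i). \<forall>t\<in>Poly_Mapping.keys (M i $$ (k, j)).
          int (mdeg t) + a i k = a (Suc i) j)
    \<and> (\<forall>i. \<forall>k<b i. \<forall>j<b (Suc i). M i $$ (k, j) \<in> irrelevant_ideal)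
    \<and> {(M 0 *\<^sub>v x) $ 0 | x. x \<in> carrier_vec (b 1)} = J
    \<and> (\<forall>i. {M (Suc i) *\<^sub>v x | x. x \<in> carrier_vec (b (Suc (Suc i)))}
          = {y \<in> carrier_vec (b (Suc i)). M i *\<^sub>v y = 0\<^sub>v (b i)})"

text \<open>
  Minimal graded free resolutions are unique up to isomorphism, so the condition on the last
  Betti number may be read off from any one of them.
\<close>

definition gorenstein_quotient :: "('v::finite, 'k::comm_ring_1) mpoly set \<Rightarrow> bool" where
  "gorenstein_quotient J \<longleftrightarrow> cohen_macaulay_quotient J
    \<and> (\<exists>p b a M. minimal_graded_free_resolution J p b a M \<and> b p = 1)"

definition gorenstein :: "('v::finite, 'k::comm_ring_1) mpoly set \<Rightarrow> bool" where
  "gorenstein I \<longleftrightarrow> gorenstein_quotient (homogenize_ideal I)"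

end

theory Submission
  imports Defs "HOL-Library.Function_Algebras"
begin

text \<open>
  Write \<open>S\<close> for the polynomial ring, \<open>R = S[u]\<close>, \<open>J = I^h\<close> and \<open>n\<close> for the number of variables of \<open>S\<close>. The
  theorem rests on two facts about the ring \<open>R / (J + (u))\<close>, which is \<open>S\<close> modulo the top-degree forms
  of the elements of \<open>I\<close>.

  First, every homogenized standard indicator function represents a nonzero element of the socle of this
  ring. It lies in the socle since \<open>(t_v - p_v) f \<in> I\<close> for an indicator function \<open>f\<close> of \<open>p\<close>
  (\<open>homogenize_indicator_socle\<close>). It is nonzero since the initial monomial of \<open>f\<close> is standard, so that the
  top form of \<open>f\<close> is not the top form of an element of \<open>I\<close> (\<open>homogenize_not_boundary\<close>).

  Second, the socle has dimension at most the last Betti number of \<open>R / J\<close> (\<open>socle_dependent\<close>). In the usual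
  language, \<open>Tor_n(R / J, K)\<close> maps isomorphically onto the socle of \<open>R / (J + (u))\<close>, and \<open>n\<close> is the projective
  dimension of \<open>R / J\<close>. Here \<open>Tor\<close> is avoided by killing the variables one after another in a minimal free
  resolution \<open>F\<close>, with \<open>u\<close> first. As \<open>u\<close> is a nonzerodivisor on \<open>R / J\<close>, killing it creates no homology in
  positive degrees. Each further variable raises the highest degree with homology by at most one
  (\<open>exact_above\<close>), and socle elements lift along the connecting maps from degree 0 to degree \<open>n\<close>
  (\<open>socle_lift\<close>, \<open>boundary_descends\<close>). When all variables are killed, the differentials vanish by
  minimality, so the homology in degree \<open>i\<close> has dimension \<open>b i\<close>. Hence \<open>b i = 0\<close> for \<open>i > n\<close>, and \<open>b n\<close> bounds
  the dimension of the socle; since the socle is nonzero, the resolution has length \<open>n\<close>.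

  If the last Betti number is 1, any two homogenized standard indicator functions are therefore linearly
  dependent modulo \<open>J + (u)\<close>. Since their top forms are reduced modulo the top forms of \<open>I\<close>, these top forms are
  proportional, and so all indicator functions have the same degree and the same initial monomial
  (\<open>gorenstein_same_initial_monomial\<close>).

  The remaining identities hold because a polynomial in the span of the standard monomials has least degree
  modulo \<open>I\<close> (\<open>standard_degree_minimal\<close>). The polynomials \<open>f\<close> with \<open>(I : f)\<close> equal to the ideal of \<open>p\<close> are the
  nonzero multiples of indicator functions of \<open>p\<close>, so the v-number at \<open>p\<close> is the degree of the
  standard one. The affine Hilbert function attains \<open>card X\<close> at \<open>d\<close> exactly if every indicator
  function can be chosen of degree at most \<open>d\<close>, so the regularity is the common degree.
\<close>

section \<open>Ideals as submodules\<close>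

lemma module_ring_mult: "Modules.module ((*) :: 'r::comm_ring_1 \<Rightarrow> 'r \<Rightarrow> 'r)"
  by unfold_locales (auto simp: algebra_simps)

lemmas ideal_subspaceI = module.subspaceI[OF module_ring_mult]
lemmas ideal_0 = module.subspace_0[OF module_ring_mult]
lemmas ideal_add = module.subspace_add[OF module_ring_mult]
lemmas ideal_scale = module.subspace_scale[OF module_ring_mult]
lemmas ideal_sum = module.subspace_sum[OF module_ring_mult]

section \<open>Killing a sequence of ring elements in a complex\<close>

text \<open>
  The locale describes a complex \<open>F\<close> of modules over a ring \<open>R\<close> together with elements
  \<open>x 0, \<dots>, x (n - 1)\<close> of \<open>R\<close> and ideals \<open>Q 0 \<subseteq> \<dots> \<subseteq> Q n\<close> with \<open>Q (k + 1) = Q k + (x k)\<close>, such that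
  \<open>x k\<close> is a nonzerodivisor on every \<open>F i / Q k F i\<close>. The ideals enter only through the submodules
  \<open>N k i = Q k F i\<close>. The last assumption says that \<open>F / Q 0 F\<close> is exact in all positive degrees.
  Elements of quotients and of homology are handled through representatives in \<open>F\<close>.
\<close>

locale reduced_complex = Modules.module scale
  for scale :: "'r::comm_ring_1 \<Rightarrow> 'm::ab_group_add \<Rightarrow> 'm" (infixr "*s" 75) +
  fixes F :: "nat \<Rightarrow> 'm set" and d :: "nat \<Rightarrow> 'm \<Rightarrow> 'm"
    and N :: "nat \<Rightarrow> nat \<Rightarrow> 'm set" and x :: "nat \<Rightarrow> 'r" and n :: nat
  assumes subspace_F: "subspace (F i)"
    and subspace_N: "subspace (N k i)"
    and N_subset: "N k i \<subseteq> F i"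
    and d_closed: "y \<in> F (Suc i) \<Longrightarrow> d i y \<in> F i"
    and d_add: "d i (y + z) = d i y + d i z"
    and d_scale: "d i (a *s y) = a *s d i y"
    and d_d: "y \<in> F (Suc (Suc i)) \<Longrightarrow> d i (d (Suc i) y) = 0"
    and d_N: "y \<in> N k (Suc i) \<Longrightarrow> d i y \<in> N k i"
    and N_Suc: "k < n \<Longrightarrow> N (Suc k) i = {x k *s y + z | y z. y \<in> F i \<and> z \<in> N k i}"
    and regular: "k < n \<Longrightarrow> y \<in> F i \<Longrightarrow> x k *s y \<in> N k i \<Longrightarrow> y \<in> N k i"
    and exact_0: "y \<in> F (Suc i) \<Longrightarrow> d i y \<in> N 0 i
          \<Longrightarrow> \<exists>w\<in>F (Suc (Suc i)). y - d (Suc i) w \<in> N 0 (Suc i)"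
begin

text \<open>
  \<open>boundaries k i\<close> consists of the elements of \<open>F i\<close> that become boundaries in \<open>F / Q k F\<close>.
\<close>

definition boundaries :: "nat \<Rightarrow> nat \<Rightarrow> 'm set" where
  "boundaries k i = {y \<in> F i. \<exists>w\<in>F (Suc i). y - d i w \<in> N k i}"

text \<open>
  The elements \<open>x j\<close> with \<open>j < k\<close> lie in \<open>Q k\<close> and act as zero. So \<open>socle_reps k\<close> represents the part
  of \<open>F k / (Q k F k + im d)\<close> annihilated by all \<open>x j\<close>; for \<open>k = 0\<close> this is
  the socle of \<open>H 0 (F / Q 0 F)\<close> with respect to the sequence \<open>x\<close>.
\<close>

definition socle_reps :: "nat \<Rightarrow> 'm set" where
  "socle_reps k = {z \<in> F k. \<forall>j. k \<le> j \<longrightarrow> j < n \<longrightarrow> x j *s z \<in> boundaries k k}"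

lemma d_diff: "d i (y - z) = d i y - d i z"
  by (metis d_add add_diff_cancel_right' diff_add_cancel)

lemmas F_intros = subspace_add[OF subspace_F] subspace_diff[OF subspace_F]
  subspace_scale[OF subspace_F] d_closed
lemmas N_intros = subspace_add[OF subspace_N] subspace_diff[OF subspace_N]
  subspace_scale[OF subspace_N] d_N

lemma N_F: "y \<in> N k i \<Longrightarrow> y \<in> F i"
  using N_subset by blast

lemma N_neg: "y \<in> N k i \<Longrightarrow> - y \<in> N k i"
  using subspace_neg[OF subspace_N] by blast

lemma N_SucI: "k < n \<Longrightarrow> y \<in> F i \<Longrightarrow> z \<in> N k i \<Longrightarrow> x k *s y + z \<in> N (Suc k) i"
  using N_Suc by blast

text \<open>
  Multiplication by \<open>x k\<close> gives a short exact sequence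
  \<open>0 \<rightarrow> F / Q k F \<rightarrow> F / Q k F \<rightarrow> F / Q (k + 1) F \<rightarrow> 0\<close>, and hence a long exact homology sequence in
  which \<open>H (i + 1) (F / Q (k + 1) F)\<close> lies between \<open>H (i + 1) (F / Q k F)\<close> and \<open>H i (F / Q k F)\<close>. Every
  killed element therefore allows homology in at most one more degree, so that
  \<open>F / Q k F\<close> is exact above degree \<open>k\<close>. The proof chases elements through this sequence.
\<close>

lemma exact_above:
  assumes "k \<le> n" "k \<le> i" "y \<in> F (Suc i)" "d i y \<in> N k i"
  shows "y \<in> boundaries k (Suc i)"
  using assms
proof (induction k arbitrary: i y)
  case 0
  then show ?case using exact_0 unfolding boundaries_def by blast
next
  case (Suc k)
  then obtain i' where i: "i = Suc i'" and "k < n" "k \<le> i'"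
    by (metis Suc_le_D Suc_le_eq Suc_le_mono)
  obtain w q where w: "w \<in> F i" "q \<in> N k i" and dy: "d i y = x k *s w + q"
    using Suc.prems N_Suc[OF \<open>k < n\<close>] by blast
  have "x k *s d i' w + d i' q = d i' (d i y)"
    by (simp add: dy d_add d_scale)
  also have "\<dots> = 0"
    using d_d Suc.prems i by blast
  finally have "x k *s d i' w = - d i' q"
    by (simp add: eq_neg_iff_add_eq_0)
  then have "d i' w \<in> N k i'"
    using regular[OF \<open>k < n\<close>] w i N_neg d_N d_closed by metis
  then have "w \<in> boundaries k i"
    using Suc.IH[of i' w] \<open>k < n\<close> \<open>k \<le> i'\<close> w i by simp
  then obtain w' where w': "w' \<in> F (Suc i)" "w - d i w' \<in> N k i"
    unfolding boundaries_def by blast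
  have "d i (y - x k *s w') = x k *s (w - d i w') + q"
    by (simp add: d_diff d_scale dy scale_right_diff_distrib)
  then have "d i (y - x k *s w') \<in> N k i"
    using w' w by (simp add: N_intros)
  then have "y - x k *s w' \<in> boundaries k (Suc i)"
    using Suc.IH[of i] Suc.prems w' by (simp add: F_intros)
  then obtain v where v: "v \<in> F (Suc (Suc i))" "y - x k *s w' - d (Suc i) v \<in> N k (Suc i)"
    unfolding boundaries_def by blast
  then have "x k *s w' + (y - x k *s w' - d (Suc i) v) \<in> N (Suc k) (Suc i)"
    using N_SucI \<open>k < n\<close> w' by blast
  then have "y - d (Suc i) v \<in> N (Suc k) (Suc i)"
    by (simp add: algebra_simps)
  then show ?case
    using v Suc.prems unfolding boundaries_def by blast
qed

text \<open>
  The connecting map \<open>H (k + 1) (F / Q (k + 1) F) \<rightarrow> H k (F / Q k F)\<close> sends the class of \<open>w\<close> to the class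
  of \<open>d w / x k\<close>. Its image is the kernel of \<open>x k\<close>, so it reaches every class that all the \<open>x j\<close>
  annihilate. That the preimage \<open>w\<close> is again annihilated by the remaining \<open>x j\<close> follows from the vanishing
  of \<open>H (k + 1) (F / Q k F)\<close>.
\<close>

lemma socle_lift:
  assumes "k < n" "z \<in> socle_reps k"
  shows "\<exists>w\<in>socle_reps (Suc k). x k *s z - d k w \<in> N k k"
proof -
  have z: "z \<in> F k" and zB: "\<And>j. k \<le> j \<Longrightarrow> j < n \<Longrightarrow> x j *s z \<in> boundaries k k"
    using assms unfolding socle_reps_def by auto
  obtain w where w: "w \<in> F (Suc k)" "x k *s z - d k w \<in> N k k"
    using zB[of k] assms unfolding boundaries_def by auto
  have "x j *s w \<in> boundaries (Suc k) (Suc k)" if j: "Suc k \<le> j" "j < n" for j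
  proof -
    obtain v where v: "v \<in> F (Suc k)" "x j *s z - d k v \<in> N k k"
      using zB[of j] j unfolding boundaries_def by auto
    \<comment> \<open>\<open>x j w\<close> and \<open>x k v\<close> have the same differential modulo \<open>Q k\<close>, and \<open>x k v\<close> dies modulo \<open>Q (k + 1)\<close>.\<close>
    have "d k (x j *s w - x k *s v) = x k *s (x j *s z - d k v) - x j *s (x k *s z - d k w)"
      by (simp add: d_diff d_scale scale_right_diff_distrib mult.commute)
    then have "d k (x j *s w - x k *s v) \<in> N k k"
      using v w by (simp add: N_intros)
    then have "x j *s w - x k *s v \<in> boundaries k (Suc k)"
      using exact_above assms w v by (simp add: F_intros)
    then obtain r where r: "r \<in> F (Suc (Suc k))"
        "x j *s w - x k *s v - d (Suc k) r \<in> N k (Suc k)"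
      unfolding boundaries_def by blast
    then have "x k *s v + (x j *s w - x k *s v - d (Suc k) r) \<in> N (Suc k) (Suc k)"
      using N_SucI assms v by blast
    then have "x j *s w - d (Suc k) r \<in> N (Suc k) (Suc k)"
      by (simp add: algebra_simps)
    then show ?thesis
      using r w unfolding boundaries_def by (auto simp: F_intros)
  qed
  then show ?thesis
    using w unfolding socle_reps_def by auto
qed

text \<open>
  The connecting map is well defined: if \<open>w\<close> is a boundary modulo \<open>Q (k + 1)\<close>, then \<open>d w / x k\<close> is one
  modulo \<open>Q k\<close>.
\<close>

lemma boundary_descends:
  assumes "k < n" "z \<in> F k" "x k *s z - d k w \<in> N k k" "w \<in> boundaries (Suc k) (Suc k)"
  shows "z \<in> boundaries k k"
proof -
  obtain v where v: "v \<in> F (Suc (Suc k))" "w - d (Suc k) v \<in> N (Suc k) (Suc k)"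
    using assms(4) unfolding boundaries_def by blast
  then obtain r q where r: "r \<in> F (Suc k)" "q \<in> N k (Suc k)"
      and eq: "w - d (Suc k) v = x k *s r + q"
    using N_Suc[OF \<open>k < n\<close>] by blast
  have "d k w = d k (w - d (Suc k) v)"
    using d_d v by (simp add: d_diff)
  also have "\<dots> = x k *s d k r + d k q"
    by (simp add: eq d_add d_scale)
  finally have "x k *s (z - d k r) = (x k *s z - d k w) + d k q"
    by (simp add: scale_right_diff_distrib)
  then have "x k *s (z - d k r) \<in> N k k"
    using assms(3) r by (simp add: N_intros)
  then have "z - d k r \<in> N k k"
    using regular assms(1,2) r by (simp add: F_intros)
  then show ?thesis
    using assms(2) r unfolding boundaries_def by blast
qed

text \<open>
  Composing the connecting maps for \<open>k, \<dots>, 1\<close> maps a subspace of the degree \<open>k\<close> part onto the socle in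
  degree 0. Instead of a linear map between quotient spaces, the statement transports dependences:
  \<open>T\<close> is any set of pairs of coefficients. With \<open>T = {(1, 0)}\<close> it transports the vanishing
  of all classes; with the pairs of scalars other than \<open>(0, 0)\<close> it transports the statement that the
  dimension is at most one.
\<close>

lemma socle_dependence_descends:
  assumes "k \<le> n"
    and dep: "\<And>z z'. z \<in> socle_reps k \<Longrightarrow> z' \<in> socle_reps k \<Longrightarrow> \<exists>(a, b)\<in>T. a *s z + b *s z' \<in> boundaries k k"
    and "z \<in> socle_reps 0" "z' \<in> socle_reps 0"
  shows "\<exists>(a, b)\<in>T. a *s z + b *s z' \<in> boundaries 0 0"
  using assms
proof (induction k arbitrary: z z')
  case 0
  then show ?case by blast
next
  case (Suc k)
  show ?case
  proof (rule Suc.IH)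
    fix z z' assume z: "z \<in> socle_reps k" "z' \<in> socle_reps k"
    have "k < n" using Suc.prems by simp
    obtain w w' where w: "w \<in> socle_reps (Suc k)" "x k *s z - d k w \<in> N k k"
        "w' \<in> socle_reps (Suc k)" "x k *s z' - d k w' \<in> N k k"
      using socle_lift[OF \<open>k < n\<close>] z by blast
    then obtain a b where ab: "(a, b) \<in> T" "a *s w + b *s w' \<in> boundaries (Suc k) (Suc k)"
      using Suc.prems(2) by blast
    have "x k *s (a *s z + b *s z') - d k (a *s w + b *s w')
        = a *s (x k *s z - d k w) + b *s (x k *s z' - d k w')"
      by (simp add: d_add d_scale scale_right_diff_distrib scale_right_distrib mult.commute)
    then have "x k *s (a *s z + b *s z') - d k (a *s w + b *s w') \<in> N k k"
      using w by (simp add: N_intros)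
    moreover have "a *s z + b *s z' \<in> F k"
      using z unfolding socle_reps_def by (auto simp: F_intros)
    ultimately show "\<exists>(a, b)\<in>T. a *s z + b *s z' \<in> boundaries k k"
      using boundary_descends[OF \<open>k < n\<close>] ab by blast
  qed (use Suc.prems in auto)
qed

end

section \<open>Polynomials as sums of terms\<close>

abbreviation mvar :: "'v \<Rightarrow> ('v, 'k::comm_ring_1) mpoly" where
  "mvar v \<equiv> Poly_Mapping.single (Poly_Mapping.single v 1) 1"

abbreviation mconst :: "'k::comm_ring_1 \<Rightarrow> ('v, 'k) mpoly" where
  "mconst c \<equiv> Poly_Mapping.single 0 c"

lemma sum_singles: "f = (\<Sum>t\<in>Poly_Mapping.keys f. Poly_Mapping.single t (Poly_Mapping.lookup f t))"
  by (rule poly_mapping_eqI)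
     (simp add: lookup_sum lookup_single when_def in_keys_iff sum.delta' if_distrib cong: if_cong)

lemma poly_mapping_single_add_induct [case_names single add]:
  fixes f :: "'a \<Rightarrow>\<^sub>0 'b::comm_monoid_add"
  assumes single: "\<And>t c. Q (Poly_Mapping.single t c)" and add: "\<And>f g. Q f \<Longrightarrow> Q g \<Longrightarrow> Q (f + g)"
  shows "Q f"
proof -
  have "Q (\<Sum>t\<in>A. Poly_Mapping.single t (Poly_Mapping.lookup f t))" if "finite A" for A
    using that
  proof (induction A)
    case empty
    show ?case using single[of undefined 0] by simp
  qed (simp add: assms)
  from this[OF finite_keys, of f] show ?thesis by (simp flip: sum_singles)
qed

lemma sum_keys_single:
  "\<phi> t 0 = 0 \<Longrightarrow> (\<Sum>s\<in>Poly_Mapping.keys (Poly_Mapping.single t c).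
    \<phi> s (Poly_Mapping.lookup (Poly_Mapping.single t c) s)) = \<phi> t c"
  by (cases "c = 0") auto

lemma lookup_single_mult:
  fixes f :: "'a::cancel_comm_monoid_add \<Rightarrow>\<^sub>0 'b::comm_semiring_0"
  shows "Poly_Mapping.lookup (Poly_Mapping.single s c * f) (s + t) = c * Poly_Mapping.lookup f t"
  by (induction f rule: poly_mapping_single_add_induct)
     (auto simp: mult_single lookup_single when_def lookup_add distrib_left)

lemma keys_single_mult:
  assumes "t \<in> Poly_Mapping.keys (Poly_Mapping.single s c * f)"
  shows "\<exists>t'\<in>Poly_Mapping.keys f. t = s + t'"
  using assms keys_mult[of "Poly_Mapping.single s c" f] by (auto split: if_splits)

lemma mdeg_add: "mdeg (s + t) = mdeg s + mdeg t"
  by (simp add: mdeg_def lookup_add sum.distrib)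

lemma mdeg_zero: "mdeg 0 = 0"
  by (simp add: mdeg_def)

lemma mdeg_single: "mdeg (Poly_Mapping.single v n) = n"
  by (simp add: mdeg_def lookup_single when_def)

lemma mdeg_le_tdeg: "t \<in> Poly_Mapping.keys f \<Longrightarrow> mdeg t \<le> tdeg f"
  by (auto simp: tdeg_def)

lemma tdeg_attained: "f \<noteq> 0 \<Longrightarrow> \<exists>t\<in>Poly_Mapping.keys f. mdeg t = tdeg f"
proof -
  assume "f \<noteq> 0"
  then have "Max (mdeg ` Poly_Mapping.keys f) \<in> mdeg ` Poly_Mapping.keys f"
    by (intro Max_in) auto
  then show ?thesis using \<open>f \<noteq> 0\<close> by (metis imageE tdeg_def)
qed

lemma eval_add: "eval_poly (f + g) x = eval_poly f x + eval_poly g x"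
  unfolding eval_poly_def by (rule setsum_keys_plus_distrib) (auto simp: distrib_right)

lemma eval_single: "eval_poly (Poly_Mapping.single t c) x = c * (\<Prod>v\<in>UNIV. x v ^ Poly_Mapping.lookup t v)"
  unfolding eval_poly_def by (rule sum_keys_single) auto

lemma eval_zero: "eval_poly 0 x = 0"
  by (simp add: eval_poly_def)

lemma eval_uminus: "eval_poly (- f) x = - eval_poly f x"
  using eval_add[of f "- f" x] by (simp add: eval_zero eq_neg_iff_add_eq_0 add.commute)

lemma eval_diff: "eval_poly (f - g) x = eval_poly f x - eval_poly g x"
  using eval_add[of f "- g" x] by (simp add: eval_uminus)

lemma eval_mult: "eval_poly (f * g) x = eval_poly f x * eval_poly g x"
proof (induction f rule: poly_mapping_single_add_induct)
  case (single t c)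
  show ?case
    by (induction g rule: poly_mapping_single_add_induct)
       (simp_all add: mult_single eval_single eval_add lookup_add power_add prod.distrib
          distrib_left distrib_right mult_ac)
qed (simp add: distrib_right eval_add)

lemma eval_const: "eval_poly (mconst c) x = c"
  by (simp add: eval_single)

lemma eval_var: "eval_poly (mvar v) x = x v"
proof -
  have "(\<Prod>w\<in>UNIV. x w ^ Poly_Mapping.lookup (Poly_Mapping.single v 1) w)
      = (\<Prod>w\<in>UNIV. if w = v then x v else 1)"
    by (rule prod.cong) (auto simp: lookup_single when_def)
  then show ?thesis by (simp add: eval_single)
qed

lemma eval_scale: "eval_poly (scale c f) x = c * eval_poly f x"
  by (simp add: scale_def eval_mult eval_const)

lemma module_scale: "Modules.module (scale :: 'k::comm_ring_1 \<Rightarrow> ('v, 'k) mpoly \<Rightarrow> _)"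
  by unfold_locales
     (simp_all add: scale_def distrib_left distrib_right single_add mult.assoc[symmetric]
        mult_single)

lemma lookup_scale: "Poly_Mapping.lookup (scale c f) t = c * Poly_Mapping.lookup f t"
  using lookup_single_mult[of 0 c f t] by (simp add: scale_def)

text \<open>
  This is the ideal generated by the variables in \<open>V\<close>, described by its monomials. In this form it is
  immediate that a variable outside \<open>V\<close> is a nonzerodivisor modulo the ideal.
\<close>

definition var_ideal :: "'v set \<Rightarrow> ('v, 'k::comm_ring_1) mpoly set" where
  "var_ideal V = {f. \<forall>t\<in>Poly_Mapping.keys f. \<exists>v\<in>V. Poly_Mapping.lookup t v \<noteq> 0}"

lemma subspace_var_ideal: "module.subspace (*) (var_ideal V)"
  unfolding module.subspace_def[OF module_ring_mult] var_ideal_def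
proof (intro conjI ballI allI, goal_cases)
  case (2 f g)
  then show ?case using keys_add[of f g] by blast
next
  case (3 c f)
  show ?case
  proof (intro CollectI ballI)
    fix t assume "t \<in> Poly_Mapping.keys (c * f)"
    then obtain a b where "t = a + b" "b \<in> Poly_Mapping.keys f"
      using keys_mult[of c f] by blast
    moreover from this obtain v where "v \<in> V" "Poly_Mapping.lookup b v \<noteq> 0"
      using 3 by blast
    ultimately show "\<exists>v\<in>V. Poly_Mapping.lookup t v \<noteq> 0"
      by (auto simp: lookup_add)
  qed
qed simp

lemma var_ideal_mono: "V \<subseteq> W \<Longrightarrow> var_ideal V \<subseteq> var_ideal W"
  unfolding var_ideal_def by blast

lemma mvar_in_var_ideal: "v \<in> V \<Longrightarrow> mvar v \<in> var_ideal V"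
  by (auto simp: var_ideal_def intro!: bexI[of _ v])

lemma var_ideal_regular:
  assumes "v \<notin> V" "mvar v * f \<in> var_ideal V"
  shows "f \<in> var_ideal V"
  unfolding var_ideal_def
proof (intro CollectI ballI)
  fix t assume "t \<in> Poly_Mapping.keys f"
  then have "Poly_Mapping.single v 1 + t \<in> Poly_Mapping.keys (mvar v * f)"
    by (simp add: in_keys_iff lookup_single_mult)
  then obtain w where "w \<in> V" "Poly_Mapping.lookup (Poly_Mapping.single v 1 + t) w \<noteq> 0"
    using assms(2) unfolding var_ideal_def by blast
  then show "\<exists>v\<in>V. Poly_Mapping.lookup t v \<noteq> 0"
    using assms(1) by (cases "v = w") (auto simp: lookup_add lookup_single_not_eq)
qed

lemma var_ideal_insert:
  "var_ideal (insert v V) = {mvar v * g + h | g h. h \<in> var_ideal V}" (is "_ = ?R")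
proof
  have sub: "module.subspace (*) ?R"
  proof (rule ideal_subspaceI)
    show "0 \<in> ?R"
      using ideal_0[OF subspace_var_ideal] by (intro CollectI exI[of _ 0]) simp
  next
    fix f f' :: "('a, 'b) mpoly" assume "f \<in> ?R" "f' \<in> ?R"
    then obtain g h g' h' where *: "f = mvar v * g + h" "f' = mvar v * g' + h'"
        "h \<in> var_ideal V" "h' \<in> var_ideal V"
      by blast
    then have "f + f' = mvar v * (g + g') + (h + h')"
      by (simp add: algebra_simps)
    then show "f + f' \<in> ?R"
      using ideal_add[OF subspace_var_ideal] * by blast
  next
    fix c f :: "('a, 'b) mpoly" assume "f \<in> ?R"
    then obtain g h where *: "f = mvar v * g + h" "h \<in> var_ideal V"
      by blast
    then have "c * f = mvar v * (c * g) + c * h"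
      by (simp add: algebra_simps)
    then show "c * f \<in> ?R"
      using ideal_scale[OF subspace_var_ideal] * by blast
  qed
  show "var_ideal (insert v V) \<subseteq> ?R"
  proof
    fix f :: "('a, 'b) mpoly" assume f: "f \<in> var_ideal (insert v V)"
    have "Poly_Mapping.single t (Poly_Mapping.lookup f t) \<in> ?R" if "t \<in> Poly_Mapping.keys f" for t
    proof (cases "Poly_Mapping.lookup t v = 0")
      case True
      then have "\<exists>w\<in>V. Poly_Mapping.lookup t w \<noteq> 0"
        using f that unfolding var_ideal_def by auto
      then have "Poly_Mapping.single t (Poly_Mapping.lookup f t) \<in> var_ideal V"
        by (auto simp: var_ideal_def)
      then show ?thesis
        by (intro CollectI exI[of _ 0] exI[of _ "Poly_Mapping.single t (Poly_Mapping.lookup f t)"]) simp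
    next
      case False
      then have "Poly_Mapping.single v 1 + (t - Poly_Mapping.single v 1) = t"
        by (intro poly_mapping_eqI) (auto simp: lookup_add lookup_minus lookup_single when_def)
      then have "Poly_Mapping.single t (Poly_Mapping.lookup f t)
          = mvar v * Poly_Mapping.single (t - Poly_Mapping.single v 1) (Poly_Mapping.lookup f t) + 0"
        by (simp add: mult_single)
      then show ?thesis
        using ideal_0[OF subspace_var_ideal] by blast
    qed
    then have "(\<Sum>t\<in>Poly_Mapping.keys f. Poly_Mapping.single t (Poly_Mapping.lookup f t)) \<in> ?R"
      by (rule ideal_sum[OF sub])
    then show "f \<in> ?R" by (subst (1) sum_singles)
  qed
  show "?R \<subseteq> var_ideal (insert v V)"
  proof clarify
    fix g h :: "('a, 'b) mpoly" assume "h \<in> var_ideal V"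
    then have "h \<in> var_ideal (insert v V)"
      using var_ideal_mono[of V "insert v V"] by blast
    moreover have "g * mvar v \<in> var_ideal (insert v V)"
      by (intro ideal_scale[OF subspace_var_ideal] mvar_in_var_ideal) simp
    ultimately show "mvar v * g + h \<in> var_ideal (insert v V)"
      using ideal_add[OF subspace_var_ideal] mult.commute[of g] by metis
  qed
qed

lemma var_ideal_empty: "var_ideal {} = {0}"
  by (auto simp: var_ideal_def)

lemma irrelevant_subset_var_ideal: "irrelevant_ideal \<subseteq> var_ideal UNIV"
  unfolding irrelevant_ideal_def
proof (rule module.span_minimal[OF module_ring_mult _ subspace_var_ideal], rule subsetI)
  fix f :: "('a, 'b) mpoly" assume "f \<in> {mvar v | v. True}"
  then obtain v where "f = mvar v" by blast
  then show "f \<in> var_ideal UNIV" using mvar_in_var_ideal[of v UNIV] by simp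
qed

section \<open>Dehomogenization of graded components\<close>

definition affine_part :: "'v::finite option monom \<Rightarrow> 'v monom" where
  "affine_part t = (\<Sum>v\<in>UNIV. Poly_Mapping.single v (Poly_Mapping.lookup t (Some v)))"

lemma lookup_affine_part: "Poly_Mapping.lookup (affine_part t) v = Poly_Mapping.lookup t (Some v)"
  by (simp add: affine_part_def lookup_sum lookup_single when_def)

lemma lookup_homogenize_monom:
  "Poly_Mapping.lookup (homogenize_monom e t) None = e - mdeg t"
  "Poly_Mapping.lookup (homogenize_monom e t) (Some v) = Poly_Mapping.lookup t v"
  by (simp_all add: homogenize_monom_def lookup_add lookup_sum lookup_single when_def)

lemma mdeg_affine_part: "mdeg t = Poly_Mapping.lookup t None + mdeg (affine_part t)"
  by (simp add: mdeg_def UNIV_option_conv sum.reindex lookup_affine_part)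

lemma affine_part_homogenize: "affine_part (homogenize_monom e t) = t"
  by (rule poly_mapping_eqI) (simp add: lookup_affine_part lookup_homogenize_monom)

lemma mdeg_homogenize_monom: "mdeg t \<le> e \<Longrightarrow> mdeg (homogenize_monom e t) = e"
  by (simp add: mdeg_affine_part affine_part_homogenize lookup_homogenize_monom)

lemma homogenize_affine_part: "homogenize_monom (mdeg t) (affine_part t) = t"
proof (rule poly_mapping_eqI)
  fix v show "Poly_Mapping.lookup (homogenize_monom (mdeg t) (affine_part t)) v = Poly_Mapping.lookup t v"
    by (cases v) (simp_all add: lookup_homogenize_monom lookup_affine_part mdeg_affine_part[of t])
qed

lemma affine_part_add: "affine_part (s + t) = affine_part s + affine_part t"
  by (rule poly_mapping_eqI) (simp add: lookup_affine_part lookup_add)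

lemma affine_part_zero: "affine_part 0 = 0"
  by (rule poly_mapping_eqI) (simp add: lookup_affine_part)

lemma affine_part_single:
  "affine_part (Poly_Mapping.single None n) = 0"
  "affine_part (Poly_Mapping.single (Some v) n) = Poly_Mapping.single v n"
  by (rule poly_mapping_eqI, simp add: lookup_affine_part lookup_single when_def)+

text \<open>
  \<open>dehom d h\<close> takes the component of \<open>h\<close> of degree \<open>d\<close> and substitutes 1 for \<open>u\<close>. On a fixed degree
  this substitution is injective, so the family of all \<open>dehom d h\<close> determines \<open>h\<close>.
\<close>

definition dehom :: "nat \<Rightarrow> ('v::finite option, 'k::comm_ring_1) mpoly \<Rightarrow> ('v, 'k) mpoly" where
  "dehom d h = (\<Sum>t\<in>Poly_Mapping.keys h.
    if mdeg t = d then Poly_Mapping.single (affine_part t) (Poly_Mapping.lookup h t) else 0)"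

lemma dehom_single:
  "dehom d (Poly_Mapping.single t c) = (if mdeg t = d then Poly_Mapping.single (affine_part t) c else 0)"
  unfolding dehom_def by (rule sum_keys_single) simp

lemma dehom_add: "dehom d (g + h) = dehom d g + dehom d h"
  unfolding dehom_def by (rule setsum_keys_plus_distrib) (auto simp: single_add)

lemma dehom_zero: "dehom d 0 = 0"
  by (simp add: dehom_def)

lemma dehom_sum: "dehom d (\<Sum>i\<in>A. h i) = (\<Sum>i\<in>A. dehom d (h i))"
  by (induction A rule: infinite_finite_induct) (simp_all add: dehom_zero dehom_add)

lemma dehom_diff: "dehom d (g - h) = dehom d g - dehom d h"
  by (metis add_diff_cancel_right' dehom_add diff_add_cancel)

lemma dehom_single_mult:
  "dehom e (Poly_Mapping.single s c * h)
    = (if mdeg s \<le> e then Poly_Mapping.single (affine_part s) c * dehom (e - mdeg s) h else 0)"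
proof (induction h rule: poly_mapping_single_add_induct)
  case (single t a)
  then show ?case
    by (auto simp: mult_single dehom_single mdeg_add affine_part_add)
qed (auto simp: distrib_left dehom_add)

lemma dehom_keys: "t \<in> Poly_Mapping.keys (dehom d h) \<Longrightarrow> mdeg t \<le> d"
proof -
  have "\<forall>t. Poly_Mapping.lookup (dehom d h) t \<noteq> 0 \<longrightarrow> mdeg t \<le> d"
  proof (induction h rule: poly_mapping_single_add_induct)
    case (single s c)
    then show ?case
      using mdeg_affine_part[of s] by (auto simp: dehom_single lookup_single when_def)
  next
    case (add f g)
    then show ?case
      by (metis dehom_add lookup_add add_cancel_right_left)
  qed
  then show "t \<in> Poly_Mapping.keys (dehom d h) \<Longrightarrow> mdeg t \<le> d"
    by (simp add: in_keys_iff)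
qed

lemma dehom_homogenize: "dehom e (homogenize f) = (if e = tdeg f then f else 0)"
proof -
  have "dehom e (homogenize f) = (\<Sum>t\<in>Poly_Mapping.keys f.
      if tdeg f = e then Poly_Mapping.single t (Poly_Mapping.lookup f t) else 0)"
    unfolding homogenize_def dehom_sum
    by (intro sum.cong refl)
       (simp add: dehom_single mdeg_homogenize_monom mdeg_le_tdeg affine_part_homogenize)
  then show ?thesis
    by (auto simp flip: sum_singles)
qed

text \<open>
  Inverse of \<open>dehom e\<close> between polynomials of degree at most \<open>e\<close> and forms of degree \<open>e\<close>. Unlike
  \<open>homogenize\<close>, it is additive.
\<close>

definition homogenize_to :: "nat \<Rightarrow> ('v::finite, 'k::comm_ring_1) mpoly \<Rightarrow> ('v option, 'k) mpoly" where
  "homogenize_to e f = (\<Sum>t\<in>Poly_Mapping.keys f.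
    Poly_Mapping.single (homogenize_monom e t) (Poly_Mapping.lookup f t))"

lemma homogenize_to_single:
  "homogenize_to e (Poly_Mapping.single t c) = Poly_Mapping.single (homogenize_monom e t) c"
  unfolding homogenize_to_def by (rule sum_keys_single) simp

lemma homogenize_to_zero: "homogenize_to e 0 = 0"
  by (simp add: homogenize_to_def)

lemma homogenize_to_add: "homogenize_to e (f + g) = homogenize_to e f + homogenize_to e g"
  unfolding homogenize_to_def by (rule setsum_keys_plus_distrib) (auto simp: single_add)

lemma lookup_homogenize_to_dehom:
  "Poly_Mapping.lookup (homogenize_to d (dehom d h)) t
    = (if mdeg t = d then Poly_Mapping.lookup h t else 0)"
proof (induction h rule: poly_mapping_single_add_induct)
  case (single s c)
  then show ?case
    by (auto simp: homogenize_to_zero dehom_single homogenize_to_single homogenize_affine_part lookup_single when_def)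
qed (simp add: dehom_add homogenize_to_add lookup_add)

lemma sum_homogenize_to_dehom: "(\<Sum>d\<le>tdeg h. homogenize_to d (dehom d h)) = h"
proof (rule poly_mapping_eqI)
  fix t show "Poly_Mapping.lookup (\<Sum>d\<le>tdeg h. homogenize_to d (dehom d h)) t = Poly_Mapping.lookup h t"
    using mdeg_le_tdeg[of t h] by (auto simp: lookup_sum lookup_homogenize_to_dehom in_keys_iff)
qed

lemma homogenize_to_eq_mult:
  assumes "tdeg f \<le> d"
  shows "homogenize_to d f
    = Poly_Mapping.single (Poly_Mapping.single None (d - tdeg f)) 1 * homogenize f"
proof -
  have "homogenize_monom d t = Poly_Mapping.single None (d - tdeg f) + homogenize_monom (tdeg f) t"
    if "t \<in> Poly_Mapping.keys f" for t
    using assms mdeg_le_tdeg[OF that]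
    by (simp add: homogenize_monom_def flip: add.assoc single_add)
  then show ?thesis
    unfolding homogenize_to_def homogenize_def sum_distrib_left
    by (intro sum.cong refl) (simp add: mult_single)
qed

text \<open>
  The right-hand side is an ideal because multiplying by a term only shifts the degree and multiplies
  the components, and it contains every \<open>homogenize f\<close>, whose only component is \<open>f\<close>. Conversely,
  the component of \<open>h\<close> of degree \<open>d\<close> is a power of \<open>u\<close> times the homogenization of \<open>dehom d h\<close>.
\<close>

lemma homogenize_ideal_eq:
  assumes I: "module.subspace (*) I"
  shows "homogenize_ideal I = {h. \<forall>d. dehom d h \<in> I}"
proof
  have scale: "dehom d (r * h) \<in> I" if "\<forall>d. dehom d h \<in> I" for d r h
  proof (induction r rule: poly_mapping_single_add_induct)
    case (single s c)
    then show ?case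
      using that ideal_scale[OF I] ideal_0[OF I] by (simp add: dehom_single_mult)
  qed (simp add: distrib_right dehom_add ideal_add[OF I])
  show "homogenize_ideal I \<subseteq> {h. \<forall>d. dehom d h \<in> I}"
    unfolding homogenize_ideal_def
  proof (rule module.span_minimal[OF module_ring_mult])
    show "homogenize ` I \<subseteq> {h. \<forall>d. dehom d h \<in> I}"
      using ideal_0[OF I] by (auto simp: dehom_homogenize)
    show "module.subspace (*) {h. \<forall>d. dehom d h \<in> I}"
      by (rule ideal_subspaceI) (auto simp: dehom_zero dehom_add scale ideal_0[OF I] ideal_add[OF I])
  qed
  show "{h. \<forall>d. dehom d h \<in> I} \<subseteq> homogenize_ideal I"
  proof clarify
    fix h :: "('a option, 'b) mpoly" assume h: "\<forall>d. dehom d h \<in> I"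
    have J: "module.subspace (*) (homogenize_ideal I)"
      unfolding homogenize_ideal_def by (rule module.subspace_span[OF module_ring_mult])
    have "homogenize_to d (dehom d h) \<in> homogenize_ideal I" for d
    proof -
      have "tdeg (dehom d h) \<le> d"
        using tdeg_attained[of "dehom d h"] dehom_keys[of _ d h] by (cases "dehom d h = 0") (auto simp: tdeg_def)
      moreover have "homogenize (dehom d h) \<in> homogenize_ideal I"
        unfolding homogenize_ideal_def using h by (auto intro: module.span_base[OF module_ring_mult])
      ultimately show ?thesis
        by (simp add: homogenize_to_eq_mult ideal_scale[OF J])
    qed
    then have "(\<Sum>d\<le>tdeg h. homogenize_to d (dehom d h)) \<in> homogenize_ideal I"
      by (intro ideal_sum[OF J])
    then show "h \<in> homogenize_ideal I"
      by (simp add: sum_homogenize_to_dehom)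
  qed
qed

lemma dehom_mvar_None: "dehom e (mvar None * h) = (if e = 0 then 0 else dehom (e - 1) h)"
  by (auto simp: dehom_single_mult mdeg_single affine_part_single)

lemma dehom_mvar_Some: "dehom e (mvar (Some v) * h) = (if e = 0 then 0 else mvar v * dehom (e - 1) h)"
  by (auto simp: dehom_single_mult mdeg_single affine_part_single)

lemma dehom_mconst: "dehom e (mconst c * h) = mconst c * dehom e h"
  by (simp add: dehom_single_mult mdeg_zero affine_part_zero)

text \<open>
  Multiplication by \<open>u\<close> shifts the family of all \<open>dehom d h\<close> by one degree and changes nothing else.
\<close>

lemma homogenize_ideal_regular:
  assumes "module.subspace (*) I" "mvar None * h \<in> homogenize_ideal I"
  shows "h \<in> homogenize_ideal I"
proof -
  have "dehom d h \<in> I" for d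
    using assms(2) unfolding homogenize_ideal_eq[OF assms(1)] mem_Collect_eq dehom_mvar_None
    by (metis diff_Suc_1 nat.distinct(1))
  then show ?thesis
    by (simp add: homogenize_ideal_eq[OF assms(1)])
qed

section \<open>The socle modulo u and the last Betti number\<close>

definition fun_scale :: "'r::comm_ring_1 \<Rightarrow> (nat \<Rightarrow> 'r) \<Rightarrow> nat \<Rightarrow> 'r" where
  "fun_scale a y = (\<lambda>j. a * y j)"

lemma module_fun_scale: "Modules.module fun_scale"
  by unfold_locales (auto simp: fun_scale_def fun_eq_iff algebra_simps)

text \<open>
  The free module of rank \<open>r\<close> is represented by the functions on \<^typ>\<open>nat\<close> that vanish from \<open>r\<close> on. In
  contrast to vectors with a carrier, these functions form one additive group for all ranks.
\<close>

definition free_module :: "nat \<Rightarrow> (nat \<Rightarrow> 'r::comm_ring_1) set" where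
  "free_module r = {y. \<forall>j\<ge>r. y j = 0}"

definition matrix_map :: "'r::comm_ring_1 mat \<Rightarrow> (nat \<Rightarrow> 'r) \<Rightarrow> nat \<Rightarrow> 'r" where
  "matrix_map A y = (\<lambda>k. if k < dim_row A then \<Sum>j<dim_col A. A $$ (k, j) * y j else 0)"

definition ideal_multiple :: "'r::comm_ring_1 set \<Rightarrow> nat \<Rightarrow> (nat \<Rightarrow> 'r) set" where
  "ideal_multiple Q r = {y \<in> free_module r. \<forall>j. y j \<in> Q}"

lemma subspace_free_module: "module.subspace fun_scale (free_module r)"
  by (rule module.subspaceI[OF module_fun_scale]) (auto simp: free_module_def fun_scale_def)

lemma subspace_ideal_multiple:
  assumes "module.subspace (*) Q"
  shows "module.subspace fun_scale (ideal_multiple Q r)"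
  by (rule module.subspaceI[OF module_fun_scale])
     (auto simp: ideal_multiple_def free_module_def fun_scale_def ideal_0[OF assms]
       ideal_add[OF assms] ideal_scale[OF assms])

lemma matrix_map_closed: "A \<in> carrier_mat r c \<Longrightarrow> matrix_map A y \<in> free_module r"
  by (auto simp: matrix_map_def free_module_def)

lemma matrix_map_add: "matrix_map A (y + z) = matrix_map A y + matrix_map A z"
  by (auto simp: matrix_map_def fun_eq_iff distrib_left sum.distrib)

lemma matrix_map_scale: "matrix_map A (fun_scale a y) = fun_scale a (matrix_map A y)"
  by (auto simp: matrix_map_def fun_scale_def fun_eq_iff sum_distrib_left mult.left_commute)

lemma matrix_map_ideal_multiple:
  assumes "module.subspace (*) Q" "A \<in> carrier_mat r c" "y \<in> ideal_multiple Q c"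
  shows "matrix_map A y \<in> ideal_multiple Q r"
  using assms unfolding ideal_multiple_def
  by (auto simp: matrix_map_closed[OF assms(2)])
     (auto simp: matrix_map_def intro!: ideal_sum ideal_scale ideal_0)

lemma matrix_map_entries_in_ideal:
  assumes "module.subspace (*) Q" "A \<in> carrier_mat r c"
    and "\<And>k j. k < r \<Longrightarrow> j < c \<Longrightarrow> A $$ (k, j) \<in> Q"
  shows "matrix_map A y \<in> ideal_multiple Q r"
  using assms matrix_map_closed[OF assms(2), of y] ideal_scale[OF assms(1)]
  unfolding ideal_multiple_def
  by (auto simp: matrix_map_def mult.commute[of _ "y _"] intro!: ideal_sum ideal_0)

lemma vec_matrix_map:
  assumes "A \<in> carrier_mat r c"
  shows "vec r (matrix_map A y) = A *\<^sub>v vec c y"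
  using assms by (intro eq_vecI) (auto simp: matrix_map_def scalar_prod_def lessThan_atLeast0)

definition vec_fun :: "'r::comm_ring_1 vec \<Rightarrow> nat \<Rightarrow> 'r" where
  "vec_fun x = (\<lambda>j. if j < dim_vec x then x $ j else 0)"

lemma vec_fun_closed: "x \<in> carrier_vec r \<Longrightarrow> vec_fun x \<in> free_module r"
  by (auto simp: vec_fun_def free_module_def)

lemma vec_vec_fun: "x \<in> carrier_vec r \<Longrightarrow> vec r (vec_fun x) = x"
  by (auto simp: vec_fun_def)

lemma free_module_eqI:
  assumes "y \<in> free_module r" "z \<in> free_module r" "vec r y = vec r z"
  shows "y = z"
proof
  fix j show "y j = z j"
    using assms index_vec[of j r y] index_vec[of j r z]
    by (cases "j < r") (auto simp: free_module_def)
qed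

lemma ideal_multiple_decompose:
  assumes "module.subspace (*) Q" "module.subspace (*) Q'"
    and Q': "Q' = {x * g + h | g h. h \<in> Q}"
  shows "ideal_multiple Q' r
    = {fun_scale x y + z | y z. y \<in> free_module r \<and> z \<in> ideal_multiple Q r}"
proof
  show "ideal_multiple Q' r \<subseteq> {fun_scale x y + z | y z. y \<in> free_module r \<and> z \<in> ideal_multiple Q r}"
  proof
    fix w assume w: "w \<in> ideal_multiple Q' r"
    then have "\<forall>j. \<exists>g h. w j = x * g + h \<and> h \<in> Q"
      unfolding ideal_multiple_def Q' by blast
    then obtain g h where gh: "\<And>j. w j = x * g j + h j" "\<And>j. h j \<in> Q"
      by metis
    have "w = fun_scale x (\<lambda>j. if j < r then g j else 0) + (\<lambda>j. if j < r then h j else 0)"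
      using w gh(1) by (auto simp: fun_eq_iff fun_scale_def ideal_multiple_def free_module_def)
    moreover have "(\<lambda>j. if j < r then h j else 0) \<in> ideal_multiple Q r"
      using gh(2) ideal_0[OF assms(1)] by (auto simp: ideal_multiple_def free_module_def)
    ultimately show "w \<in> {fun_scale x y + z | y z. y \<in> free_module r \<and> z \<in> ideal_multiple Q r}"
      by (intro CollectI exI[of _ "\<lambda>j. if j < r then g j else 0"]
          exI[of _ "\<lambda>j. if j < r then h j else 0"]) (auto simp: free_module_def)
  qed
  show "{fun_scale x y + z | y z. y \<in> free_module r \<and> z \<in> ideal_multiple Q r} \<subseteq> ideal_multiple Q' r"
    unfolding Q' by (auto simp: ideal_multiple_def free_module_def fun_scale_def) blast
qed

text \<open>
  \<open>J\<close> is an ideal of \<open>R = S[u]\<close> modulo which \<open>u\<close> is a nonzerodivisor. The list \<open>vs\<close> fixes the order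
  in which the variables of \<open>S\<close> are killed, after \<open>u\<close>.
\<close>

locale resolution =
  fixes J :: "('v::finite option, 'k::field) mpoly set"
    and p :: nat and b :: "nat \<Rightarrow> nat" and a :: "nat \<Rightarrow> nat \<Rightarrow> int"
    and M :: "nat \<Rightarrow> ('v option, 'k) mpoly mat" and vs :: "'v list"
  assumes res: "minimal_graded_free_resolution J p b a M"
    and subspace_J: "module.subspace (*) J"
    and regular_J: "\<And>h. mvar None * h \<in> J \<Longrightarrow> h \<in> J"
    and vs: "distinct vs" "set vs = UNIV"
begin

lemma b_0: "b 0 = 1"
  and b_p: "b p \<noteq> 0"
  and b_above [rule_format]: "\<forall>i>p. b i = 0"
  and M_carrier [rule_format]: "\<forall>i. M i \<in> carrier_mat (b i) (b (Suc i))"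
  and M_irrelevant [rule_format]:
    "\<forall>i. \<forall>k<b i. \<forall>j<b (Suc i). M i $$ (k, j) \<in> irrelevant_ideal"
  and M_0: "{(M 0 *\<^sub>v x) $ 0 | x. x \<in> carrier_vec (b 1)} = J"
  and M_exact [rule_format]: "\<forall>i. {M (Suc i) *\<^sub>v x | x. x \<in> carrier_vec (b (Suc (Suc i)))}
          = {y \<in> carrier_vec (b (Suc i)). M i *\<^sub>v y = 0\<^sub>v (b i)}"
  using res[unfolded minimal_graded_free_resolution_def] by - (elim conjE, assumption)+

abbreviation F :: "nat \<Rightarrow> (nat \<Rightarrow> ('v option, 'k) mpoly) set" where
  "F i \<equiv> free_module (b i)"

abbreviation d where "d i \<equiv> matrix_map (M i)"

definition killed :: "nat \<Rightarrow> 'v option set" where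
  "killed k = insert None (Some ` set (take k vs))"

abbreviation N where "N k i \<equiv> ideal_multiple (var_ideal (killed k)) (b i)"

lemma d_diff: "d i (y - z) = d i y - d i z"
  by (metis add_diff_cancel_right' matrix_map_add diff_add_cancel)

lemma d_d: "y \<in> F (Suc (Suc i)) \<Longrightarrow> d i (d (Suc i) y) = 0"
proof (rule free_module_eqI[OF matrix_map_closed[OF M_carrier]])
  have "M (Suc i) *\<^sub>v vec (b (Suc (Suc i))) y \<in> {y \<in> carrier_vec (b (Suc i)). M i *\<^sub>v y = 0\<^sub>v (b i)}"
    unfolding M_exact[symmetric] by auto
  then show "vec (b i) (d i (d (Suc i) y)) = vec (b i) 0"
    by (auto simp: vec_matrix_map[OF M_carrier])
qed (simp add: free_module_def)

lemma exact_d: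
  assumes "y \<in> F (Suc i)" "d i y = 0"
  shows "\<exists>w\<in>F (Suc (Suc i)). d (Suc i) w = y"
proof -
  have "M i *\<^sub>v vec (b (Suc i)) y = vec (b i) 0"
    using vec_matrix_map[OF M_carrier, of i y] assms by simp
  also have "\<dots> = 0\<^sub>v (b i)"
    by auto
  finally have "vec (b (Suc i)) y \<in> {y \<in> carrier_vec (b (Suc i)). M i *\<^sub>v y = 0\<^sub>v (b i)}"
    by simp
  then obtain x where x: "x \<in> carrier_vec (b (Suc (Suc i)))" "M (Suc i) *\<^sub>v x = vec (b (Suc i)) y"
    unfolding M_exact[symmetric] by auto
  have "d (Suc i) (vec_fun x) = y"
    using x assms
    by (intro free_module_eqI[OF matrix_map_closed[OF M_carrier]])
       (auto simp: vec_matrix_map[OF M_carrier] vec_vec_fun)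
  then show ?thesis
    using vec_fun_closed[OF x(1)] by blast
qed

lemma range_d_0:
  assumes "w \<in> F 0"
  shows "w 0 \<in> J \<longleftrightarrow> (\<exists>v\<in>F 1. d 0 v = w)"
proof
  assume "w 0 \<in> J"
  then obtain x where x: "x \<in> carrier_vec (b 1)" "(M 0 *\<^sub>v x) $ 0 = w 0"
    using M_0 by auto
  have "d 0 (vec_fun x) = w"
  proof (rule free_module_eqI[OF matrix_map_closed[OF M_carrier] assms])
    have "vec (b 0) (d 0 (vec_fun x)) = M 0 *\<^sub>v x"
      using x by (simp add: vec_matrix_map[OF M_carrier] vec_vec_fun)
    also have "\<dots> = vec (b 0) w"
    proof (rule eq_vecI)
      fix k assume "k < dim_vec (vec (b 0) w)"
      then have "k = 0" "0 < b 0" using b_0 by auto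
      then show "(M 0 *\<^sub>v x) $ k = vec (b 0) w $ k"
        using x(2) by (simp del: index_mult_mat_vec)
    qed (use M_carrier[of 0] in auto)
    finally show "vec (b 0) (d 0 (vec_fun x)) = vec (b 0) w" .
  qed
  then show "\<exists>v\<in>F 1. d 0 v = w"
    using vec_fun_closed[OF x(1)] by blast
next
  assume "\<exists>v\<in>F 1. d 0 v = w"
  then obtain v where v: "d 0 v = w" by blast
  have "(M 0 *\<^sub>v vec (b 1) v) $ 0 = w 0"
    using vec_matrix_map[OF M_carrier, of 0 v] v b_0
    by (metis One_nat_def index_vec less_Suc_eq)
  then show "w 0 \<in> J"
    using M_0 by (metis (mono_tags, lifting) mem_Collect_eq vec_carrier)
qed

text \<open>
  Exactness of \<open>F / u F\<close> in positive degrees: \<open>F\<close> resolves \<open>R / J\<close>, and \<open>u\<close> is a nonzerodivisor both on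
  \<open>R / J\<close> (used at \<open>F 0\<close>) and on the free modules (used further up).
\<close>

lemma exact_0:
  assumes y: "y \<in> F (Suc i)" "d i y \<in> N 0 i"
  shows "\<exists>w\<in>F (Suc (Suc i)). y - d (Suc i) w \<in> N 0 (Suc i)"
proof -
  have k0: "killed 0 = insert None {}"
    by (simp add: killed_def)
  have "d i y \<in> {fun_scale (mvar None) w + z | w z. w \<in> F i \<and> z \<in> ideal_multiple (var_ideal {}) (b i)}"
    using ideal_multiple_decompose[OF subspace_var_ideal subspace_var_ideal var_ideal_insert[of None "{}"], of "b i"] y
    unfolding k0 by blast
  then obtain w where w: "w \<in> F i" "d i y = fun_scale (mvar None) w"
    by (auto simp: ideal_multiple_def var_ideal_empty fun_eq_iff)
  have cancel: "h = 0" if "mvar None * h = 0" for h :: "('v option, 'k) mpoly"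
    using var_ideal_regular[of None "{}" h] that by (simp add: var_ideal_empty)
  have "\<exists>w'\<in>F (Suc i). d i w' = w"
  proof (cases i)
    case 0
    then have "mvar None * w 0 \<in> J"
      using range_d_0[of "fun_scale (mvar None) w"] w y
      by (metis One_nat_def fun_scale_def M_carrier matrix_map_closed)
    then show ?thesis
      using regular_J range_d_0 w(1) 0 by auto
  next
    case (Suc i')
    have "fun_scale (mvar None) (d i' w) = d i' (d i y)"
      by (simp add: w matrix_map_scale)
    also have "\<dots> = 0"
      using d_d y Suc by blast
    finally have "d i' w = 0"
      using cancel by (auto simp: fun_scale_def fun_eq_iff)
    then show ?thesis
      using exact_d w Suc by blast
  qed
  then obtain w' where w': "w' \<in> F (Suc i)" "d i w' = w"
    by blast
  have "d i (y - fun_scale (mvar None) w') = 0"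
    by (simp add: d_diff matrix_map_scale w w')
  moreover have "y - fun_scale (mvar None) w' \<in> F (Suc i)"
    using y w' by (simp add: free_module_def fun_scale_def)
  ultimately obtain v where v: "v \<in> F (Suc (Suc i))" "d (Suc i) v = y - fun_scale (mvar None) w'"
    using exact_d by blast
  have "fun_scale (mvar None) w' \<in> N 0 (Suc i)"
    using w' ideal_scale[OF subspace_var_ideal mvar_in_var_ideal[of None "killed 0"]]
    by (auto simp: ideal_multiple_def free_module_def fun_scale_def k0 mult.commute)
  then show ?thesis
    using v by (intro bexI[of _ v]) auto
qed

sublocale reduced_complex fun_scale F d N "\<lambda>k. mvar (Some (vs ! k))" "length vs"
proof (intro reduced_complex.intro module_fun_scale reduced_complex_axioms.intro)
  fix k i y assume k: "k < length vs"
  have "Some (vs ! k) \<notin> killed k"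
    using k vs by (auto simp: killed_def in_set_conv_nth nth_eq_iff_index_eq)
  have eq: "killed (Suc k) = insert (Some (vs ! k)) (killed k)"
    using k by (auto simp: killed_def take_Suc_conv_app_nth)
  show "N (Suc k) i = {fun_scale (mvar (Some (vs ! k))) y + z | y z. y \<in> F i \<and> z \<in> N k i}"
    unfolding eq
    by (rule ideal_multiple_decompose[OF subspace_var_ideal subspace_var_ideal var_ideal_insert])
  assume "y \<in> F i" "fun_scale (mvar (Some (vs ! k))) y \<in> N k i"
  then show "y \<in> N k i"
    using var_ideal_regular[OF \<open>Some (vs ! k) \<notin> killed k\<close>]
    by (auto simp: ideal_multiple_def fun_scale_def)
next
  fix k i y
  show "module.subspace fun_scale (N k i)"
    by (rule subspace_ideal_multiple[OF subspace_var_ideal])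
  show "N k i \<subseteq> F i"
    by (auto simp: ideal_multiple_def)
  show "y \<in> N k (Suc i) \<Longrightarrow> d i y \<in> N k i"
    by (rule matrix_map_ideal_multiple[OF subspace_var_ideal M_carrier])
qed (rule subspace_free_module matrix_map_closed[OF M_carrier] matrix_map_add matrix_map_scale
      exact_0 d_d; assumption)+

text \<open>
  This identifies \<open>R\<close> with \<open>F 0\<close>, and with the first coordinate axis of any nonzero \<open>F i\<close>.
  In \<open>F 0\<close>, the boundaries modulo \<open>u\<close> form the ideal \<open>J + (u)\<close>.
\<close>

abbreviation emb :: "('v option, 'k) mpoly \<Rightarrow> nat \<Rightarrow> ('v option, 'k) mpoly" where
  "emb z \<equiv> (\<lambda>j. if j = 0 then z else 0)"

lemma emb_boundary_iff: "emb z \<in> boundaries 0 0 \<longleftrightarrow> (\<exists>g. z - mvar None * g \<in> J)"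
proof
  assume "emb z \<in> boundaries 0 0"
  then obtain w where w: "w \<in> F 1" "emb z - d 0 w \<in> N 0 0"
    unfolding boundaries_def by auto
  then have "z - d 0 w 0 \<in> var_ideal (insert None {})"
    unfolding ideal_multiple_def killed_def by (auto dest: spec[of _ 0])
  then obtain g where g: "z - d 0 w 0 = mvar None * g"
    unfolding var_ideal_insert var_ideal_empty by auto
  have "d 0 w 0 \<in> J"
    using range_d_0[OF matrix_map_closed[OF M_carrier]] w by blast
  then have "z - mvar None * g \<in> J"
    using g by (simp add: algebra_simps)
  then show "\<exists>g. z - mvar None * g \<in> J" ..
next
  assume "\<exists>g. z - mvar None * g \<in> J"
  then obtain g where "emb (z - mvar None * g) 0 \<in> J"
    by auto
  moreover have "emb (z - mvar None * g) \<in> F 0"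
    by (simp add: free_module_def b_0)
  ultimately obtain w where w: "w \<in> F 1" "d 0 w = emb (z - mvar None * g)"
    using range_d_0 by blast
  have "mvar None * g \<in> var_ideal (killed 0)"
    using ideal_scale[OF subspace_var_ideal mvar_in_var_ideal[of None "killed 0"], of g]
    by (simp add: killed_def mult.commute)
  then have "emb z - d 0 w \<in> N 0 0"
    unfolding w(2)
    by (auto simp: ideal_multiple_def free_module_def b_0 ideal_0[OF subspace_var_ideal])
  moreover have "emb z \<in> F 0"
    by (simp add: free_module_def b_0)
  ultimately show "emb z \<in> boundaries 0 0"
    using w(1) unfolding boundaries_def One_nat_def by blast
qed

text \<open>
  The representatives in \<open>R\<close> of the socle of \<open>R / (J + (u))\<close>. The variable \<open>u\<close> acts as zero there, so only
  the variables of \<open>S\<close> need to be mentioned.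
\<close>

definition socle :: "('v option, 'k) mpoly set" where
  "socle = {z. \<forall>v. \<exists>g. mvar (Some v) * z - mvar None * g \<in> J}"

lemma emb_socle: "z \<in> socle \<Longrightarrow> emb z \<in> socle_reps 0"
proof -
  assume z: "z \<in> socle"
  have "fun_scale (mvar (Some v)) (emb z) = emb (mvar (Some v) * z)" for v
    by (auto simp: fun_scale_def)
  moreover have "emb (mvar (Some v) * z) \<in> boundaries 0 0" for v
    using z unfolding emb_boundary_iff socle_def by blast
  moreover have "emb z \<in> F 0"
    by (simp add: free_module_def b_0)
  ultimately show "emb z \<in> socle_reps 0"
    unfolding socle_reps_def by simp
qed

lemma killed_all: "killed (length vs) = UNIV"
  using vs by (auto simp: killed_def UNIV_option_conv)

lemma d_minimal: "d i y \<in> N (length vs) i"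
  using irrelevant_subset_var_ideal M_irrelevant[of _ i]
  by (intro matrix_map_entries_in_ideal[OF subspace_var_ideal M_carrier]) (auto simp: killed_all)

text \<open>
  Once all variables are killed, the differentials vanish by minimality. So \<open>F i\<close> modulo the variables is its
  own homology, which is zero for \<open>i\<close> greater than the number of variables of \<open>S\<close>.
\<close>

lemma betti_above:
  assumes "i \<ge> length vs"
  shows "b (Suc i) = 0"
proof (rule ccontr)
  assume "b (Suc i) \<noteq> 0"
  then have "emb 1 \<in> F (Suc i)"
    by (simp add: free_module_def)
  then have "emb 1 \<in> boundaries (length vs) (Suc i)"
    using exact_above[OF le_refl assms] d_minimal by blast
  then obtain w where "emb 1 - d (Suc i) w \<in> N (length vs) (Suc i)"
    unfolding boundaries_def by blast
  then have "(emb 1 - d (Suc i) w) + d (Suc i) w \<in> N (length vs) (Suc i)"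
    using d_minimal by (rule subspace_add[OF subspace_N])
  then have "(emb 1 :: nat \<Rightarrow> ('v option, 'k) mpoly) 0 \<in> var_ideal UNIV"
    unfolding ideal_multiple_def killed_all diff_add_cancel by blast
  then show False
    by (simp add: var_ideal_def)
qed

text \<open>
  A nonzero socle element of \<open>R / (J + (u))\<close> lifts to a nonzero element of \<open>F n\<close> modulo the variables,
  where \<open>n\<close> is the number of variables of \<open>S\<close>. So \<open>b n \<noteq> 0\<close>, and the resolution has length exactly \<open>n\<close>.
\<close>

lemma betti_length:
  assumes "z \<in> socle" "\<nexists>g. z - mvar None * g \<in> J"
  shows "p = length vs"
proof (rule ccontr)
  assume "p \<noteq> length vs"
  moreover have "p \<le> length vs"
  proof (rule ccontr)
    assume "\<not> p \<le> length vs"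
    then obtain q where "p = Suc q" "q \<ge> length vs"
      by (cases p) auto
    then show False
      using betti_above b_p by simp
  qed
  ultimately have b0: "b (length vs) = 0"
    using b_above by simp
  have "\<exists>(a, b)\<in>{(1, 0)}. fun_scale a z + fun_scale b z' \<in> boundaries (length vs) (length vs)"
    if "z \<in> socle_reps (length vs)" for z z'
  proof -
    have "z \<in> F (length vs)"
      using that unfolding socle_reps_def by blast
    then have "z = 0"
      using b0 by (simp add: free_module_def fun_eq_iff)
    then have "fun_scale 1 z + fun_scale 0 z' = 0"
      by (simp add: fun_scale_def fun_eq_iff)
    moreover have "0 \<in> boundaries (length vs) (length vs)"
      using subspace_0[OF subspace_F] subspace_0[OF subspace_N] matrix_map_scale[of "M _" 0 0]
      unfolding boundaries_def by (auto intro!: bexI[of _ 0] simp: fun_scale_def zero_fun_def)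
    ultimately show ?thesis
      by simp
  qed
  then have "\<exists>(a, b)\<in>{(1, 0)}. fun_scale a (emb z) + fun_scale b (emb z) \<in> boundaries 0 0"
    using socle_dependence_descends[OF le_refl, of "{(1, 0)}" "emb z" "emb z"] emb_socle assms(1)
    by blast
  moreover have "fun_scale 1 (emb z) + fun_scale 0 (emb z) = emb z"
    by (simp add: fun_scale_def fun_eq_iff)
  ultimately have "emb z \<in> boundaries 0 0"
    by simp
  then show False
    using assms(2) unfolding emb_boundary_iff by blast
qed

text \<open>
  The socle of \<open>R / (J + (u))\<close> has dimension at most \<open>b n\<close>, which is the last Betti number by
  \<open>betti_length\<close>. If it is 1, then any two socle elements are linearly dependent.
\<close>

lemma socle_dependent:
  assumes "b p = 1" "z \<in> socle" "\<nexists>g. z - mvar None * g \<in> J" "z' \<in> socle"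
  shows "\<exists>\<alpha> \<beta> g. (\<alpha>, \<beta>) \<noteq> (0, 0) \<and> mconst \<alpha> * z + mconst \<beta> * z' - mvar None * g \<in> J"
proof -
  define T :: "(('v option, 'k) mpoly \<times> ('v option, 'k) mpoly) set"
    where "T = {(mconst \<alpha>, mconst \<beta>) | \<alpha> \<beta>. (\<alpha>, \<beta>) \<noteq> (0, 0)}"
  let ?n = "length vs"
  have b1: "b ?n = 1"
    using betti_length[OF assms(2,3)] assms(1) by simp
  have "\<exists>(a, b)\<in>T. fun_scale a y + fun_scale b y' \<in> boundaries ?n ?n"
    if y: "y \<in> socle_reps ?n" "y' \<in> socle_reps ?n" for y y'
  proof -
    have F: "y \<in> F ?n" "y' \<in> F ?n"
      using y unfolding socle_reps_def by auto
    \<comment> \<open>Modulo the variables, \<open>F n\<close> has rank one, and only the constant terms survive.\<close>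
    define \<gamma> \<gamma>' where "\<gamma> = Poly_Mapping.lookup (y 0) 0" "\<gamma>' = Poly_Mapping.lookup (y' 0) 0"
    obtain \<alpha> \<beta> where ab: "(\<alpha>, \<beta>) \<noteq> (0, 0)" "\<alpha> * \<gamma> + \<beta> * \<gamma>' = 0"
    proof (cases "\<gamma> = 0")
      case True
      then show ?thesis using that[of 1 0] by simp
    next
      case False
      then show ?thesis using that[of "\<gamma>'" "- \<gamma>"] by simp
    qed
    let ?w = "fun_scale (mconst \<alpha>) y + fun_scale (mconst \<beta>) y'"
    have "Poly_Mapping.lookup (mconst c * h) 0 = c * Poly_Mapping.lookup h 0"
      for c :: 'k and h :: "('v option, 'k) mpoly"
      using lookup_single_mult[of 0 c h 0] by simp
    then have "Poly_Mapping.lookup (?w 0) 0 = 0"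
      using ab(2) by (simp add: fun_scale_def lookup_add \<gamma>_\<gamma>'_def)
    then have "?w 0 \<in> var_ideal UNIV"
      by (auto simp: var_ideal_def in_keys_iff poly_mapping_eq_iff fun_eq_iff)
         (metis poly_mapping_eqI lookup_zero gr0I)
    moreover have "?w j = 0" if "j \<noteq> 0" for j
      using F b1 that by (auto simp: free_module_def fun_scale_def)
    ultimately have "?w j \<in> var_ideal UNIV" for j
      by (cases "j = 0") (simp_all only: ideal_0[OF subspace_var_ideal] simp_thms)
    moreover have "?w \<in> F ?n"
      using F by (intro F_intros)
    ultimately have "?w \<in> N ?n ?n"
      unfolding ideal_multiple_def killed_all by blast
    moreover have "d ?n 0 = 0"
      using matrix_map_scale[of "M ?n" 0 0] by (simp add: fun_scale_def zero_fun_def)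
    ultimately have "?w \<in> boundaries ?n ?n"
      using N_F subspace_0[OF subspace_F] unfolding boundaries_def by (auto intro!: bexI[of _ 0])
    then show ?thesis
      using ab(1) unfolding T_def by blast
  qed
  then have "\<exists>(a, b)\<in>T. fun_scale a (emb z) + fun_scale b (emb z') \<in> boundaries 0 0"
    using socle_dependence_descends[OF le_refl, of T "emb z" "emb z'"] emb_socle assms(2,4)
    by blast
  then obtain \<alpha> \<beta> where ab: "(\<alpha>, \<beta>) \<noteq> (0, 0)"
      "fun_scale (mconst \<alpha>) (emb z) + fun_scale (mconst \<beta>) (emb z') \<in> boundaries 0 0"
    unfolding T_def by blast
  moreover have "fun_scale (mconst \<alpha>) (emb z) + fun_scale (mconst \<beta>) (emb z')
      = emb (mconst \<alpha> * z + mconst \<beta> * z')"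
    by (auto simp: fun_scale_def fun_eq_iff)
  ultimately show ?thesis
    using emb_boundary_iff by metis
qed

end

section \<open>Standard monomials and standard indicator functions\<close>

lemma finite_mdeg_le: "finite {t :: 'v::finite monom. mdeg t \<le> d}"
proof (rule inj_on_finite)
  show "inj_on Poly_Mapping.lookup {t :: 'v monom. mdeg t \<le> d}"
    by (intro inj_onI) (simp only: poly_mapping.lookup_inject)
  show "Poly_Mapping.lookup ` {t. mdeg t \<le> d} \<subseteq> PiE UNIV (\<lambda>v::'v. {..d})"
  proof (intro image_subsetI PiE_I)
    fix t :: "'v monom" and v assume "t \<in> {t. mdeg t \<le> d}"
    moreover have "Poly_Mapping.lookup t v \<le> mdeg t"
      unfolding mdeg_def by (rule member_le_sum) auto
    ultimately show "Poly_Mapping.lookup t v \<in> {..d}" by simp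
  qed simp
  show "finite (PiE UNIV (\<lambda>v::'v. {..d}))"
    by (intro finite_PiE) auto
qed

locale graded_order =
  fixes prec :: "'v::finite monom \<Rightarrow> 'v monom \<Rightarrow> bool" (infix "\<prec>" 50)
  assumes graded: "graded_monomial_order prec"
begin

lemma prec_irrefl: "\<not> t \<prec> t"
  and prec_trans: "r \<prec> s \<Longrightarrow> s \<prec> t \<Longrightarrow> r \<prec> t"
  and prec_total: "s \<noteq> t \<Longrightarrow> s \<prec> t \<or> t \<prec> s"
  and prec_add: "s \<prec> t \<Longrightarrow> s + r \<prec> t + r"
  and prec_mdeg: "mdeg s < mdeg t \<Longrightarrow> s \<prec> t"
  using graded unfolding graded_monomial_order_def monomial_order_def
  by (blast dest: irreflpD transpD totalpD)+

text \<open>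
  A graded order is well-founded because only finitely many monomials lie below \<open>t\<close>: their degree is at
  most that of \<open>t\<close>.
\<close>

lemma prec_induct [case_names less]:
  assumes "\<And>t. (\<And>s. s \<prec> t \<Longrightarrow> Q s) \<Longrightarrow> Q t"
  shows "Q t"
proof (induction "card {s. s \<prec> t}" arbitrary: t rule: less_induct)
  case less
  have fin: "finite {s. s \<prec> t}" for t
    by (rule finite_subset[OF _ finite_mdeg_le[of "mdeg t"]])
       (use prec_mdeg prec_irrefl prec_trans not_le in blast)
  show ?case
  proof (rule assms)
    fix s assume "s \<prec> t"
    then have "{r. r \<prec> s} \<subset> {r. r \<prec> t}"
      using prec_trans prec_irrefl by blast
    then show "Q s"
      using less psubset_card_mono[OF fin] by blast
  qed
qed

lemma initial_monomial_eqI: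
  assumes "t \<in> Poly_Mapping.keys f" "\<And>s. s \<in> Poly_Mapping.keys f \<Longrightarrow> s \<noteq> t \<Longrightarrow> s \<prec> t"
  shows "initial_monomial prec f = t"
  unfolding initial_monomial_def
proof (rule the_equality)
  fix s assume s: "s \<in> Poly_Mapping.keys f \<and> (\<forall>t'\<in>Poly_Mapping.keys f. t' \<noteq> s \<longrightarrow> t' \<prec> s)"
  show "s = t"
  proof (rule ccontr)
    assume "s \<noteq> t"
    then have "s \<prec> t" "t \<prec> s"
      using s assms by auto
    then show False
      using prec_trans prec_irrefl by blast
  qed
qed (use assms in blast)

lemma initial_monomial_exists:
  assumes "f \<noteq> 0"
  shows "\<exists>t\<in>Poly_Mapping.keys f. \<forall>s\<in>Poly_Mapping.keys f. s \<noteq> t \<longrightarrow> s \<prec> t"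
proof -
  have "\<exists>t\<in>Poly_Mapping.keys f. \<forall>s\<in>Poly_Mapping.keys f. s \<noteq> t \<longrightarrow> \<not> t \<prec> s"
    by (rule Finite_Set.bex_max_element)
       (use assms prec_trans prec_irrefl in \<open>auto simp: asymp_on_def transp_on_def\<close>)
  then show ?thesis
    using prec_total by blast
qed

lemma initial_monomial_in_keys: "f \<noteq> 0 \<Longrightarrow> initial_monomial prec f \<in> Poly_Mapping.keys f"
  using initial_monomial_exists initial_monomial_eqI by metis

lemma initial_monomial_greatest:
  "s \<in> Poly_Mapping.keys f \<Longrightarrow> s \<noteq> initial_monomial prec f \<Longrightarrow> s \<prec> initial_monomial prec f"
  using initial_monomial_exists initial_monomial_eqI by (metis keys_zero empty_iff)

lemma mdeg_initial_monomial: "f \<noteq> 0 \<Longrightarrow> mdeg (initial_monomial prec f) = tdeg f"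
proof (rule antisym)
  assume f: "f \<noteq> 0"
  then show "mdeg (initial_monomial prec f) \<le> tdeg f"
    by (intro mdeg_le_tdeg initial_monomial_in_keys)
  obtain t where t: "t \<in> Poly_Mapping.keys f" "mdeg t = tdeg f"
    using tdeg_attained[OF f] by blast
  have "\<not> initial_monomial prec f \<prec> t"
    using initial_monomial_greatest[OF t(1)] prec_irrefl prec_trans by blast
  then show "tdeg f \<le> mdeg (initial_monomial prec f)"
    using prec_mdeg[of "initial_monomial prec f" t] t(2) by fastforce
qed

lemma initial_monomial_single_mult:
  fixes f :: "('v, 'k::comm_ring_1) mpoly"
  assumes "f \<noteq> 0"
  shows "initial_monomial prec (Poly_Mapping.single s 1 * f) = s + initial_monomial prec f"
proof (rule initial_monomial_eqI)
  show "s + initial_monomial prec f \<in> Poly_Mapping.keys (Poly_Mapping.single s 1 * f)"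
    using initial_monomial_in_keys[OF assms] by (simp add: in_keys_iff lookup_single_mult)
next
  fix t assume "t \<in> Poly_Mapping.keys (Poly_Mapping.single s 1 * f)"
    and "t \<noteq> s + initial_monomial prec f"
  then obtain t' where "t = s + t'" "t' \<in> Poly_Mapping.keys f" "t' \<noteq> initial_monomial prec f"
    using keys_single_mult by metis
  then show "t \<prec> s + initial_monomial prec f"
    using prec_add[OF initial_monomial_greatest, of t' f s] by (simp add: add.commute)
qed

lemma single_mult_nonzero:
  fixes f :: "('v, 'k::comm_ring_1) mpoly"
  assumes "f \<noteq> 0"
  shows "Poly_Mapping.single s 1 * f \<noteq> 0"
proof
  assume "Poly_Mapping.single s 1 * f = 0"
  then have "Poly_Mapping.lookup f t = 0" for t
    using lookup_single_mult[of s 1 f t] by simp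
  then show False
    using assms by (metis poly_mapping_eqI lookup_zero)
qed

lemma standard_span_iff:
  fixes f :: "('v, 'k::comm_ring_1) mpoly"
  shows "f \<in> standard_span prec I \<longleftrightarrow> Poly_Mapping.keys f \<subseteq> standard_monomials prec I"
proof
  let ?S = "{f :: ('v, 'k) mpoly. Poly_Mapping.keys f \<subseteq> standard_monomials prec I}"
  have "module.subspace scale ?S"
  proof (rule module.subspaceI[OF module_scale], goal_cases)
    case (2 f g)
    then show ?case using keys_add[of f g] by blast
  next
    case (3 c f)
    have "Poly_Mapping.keys (scale c f) \<subseteq> Poly_Mapping.keys f"
      by (auto simp: in_keys_iff lookup_scale)
    then show ?case using 3 by blast
  qed simp
  then have "standard_span prec I \<subseteq> ?S"
    unfolding standard_span_def by (intro module.span_minimal[OF module_scale]) auto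
  then show "f \<in> standard_span prec I \<Longrightarrow> Poly_Mapping.keys f \<subseteq> standard_monomials prec I"
    by blast
next
  assume *: "Poly_Mapping.keys f \<subseteq> standard_monomials prec I"
  have "Poly_Mapping.single t (Poly_Mapping.lookup f t) \<in> standard_span prec I"
    if "t \<in> Poly_Mapping.keys f" for t
  proof -
    have "Poly_Mapping.single t 1 \<in> standard_span prec I"
      unfolding standard_span_def using * that by (intro module.span_base[OF module_scale]) auto
    then have "scale (Poly_Mapping.lookup f t) (Poly_Mapping.single t 1) \<in> standard_span prec I"
      unfolding standard_span_def by (rule module.span_scale[OF module_scale])
    then show ?thesis
      by (simp add: scale_def mult_single)
  qed
  then have "(\<Sum>t\<in>Poly_Mapping.keys f. Poly_Mapping.single t (Poly_Mapping.lookup f t)) \<in> standard_span prec I"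
    unfolding standard_span_def by (rule module.span_sum[OF module_scale])
  then show "f \<in> standard_span prec I"
    by (simp flip: sum_singles)
qed

text \<open>
  The initial monomials of \<open>I\<close> are closed under multiplication by monomials. Hence the
  polynomials all of whose monomials are initial monomials of \<open>I\<close> already form an ideal, and
  the initial ideal contains no further monomial.
\<close>

lemma nonstandard_initial:
  fixes I :: "('v, 'k::comm_ring_1) mpoly set"
  assumes I: "module.subspace (*) I" and "t \<notin> standard_monomials prec I"
  shows "\<exists>g\<in>I. g \<noteq> 0 \<and> initial_monomial prec g = t"
proof -
  let ?S = "{h :: ('v, 'k) mpoly. \<forall>t\<in>Poly_Mapping.keys h. \<exists>g\<in>I. g \<noteq> 0 \<and> initial_monomial prec g = t}"
  have "module.subspace (*) ?S"
  proof (rule ideal_subspaceI, goal_cases)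
    case (2 f g)
    then show ?case using keys_add[of f g] by blast
  next
    case (3 c f)
    show ?case
    proof (intro CollectI ballI)
      fix t assume "t \<in> Poly_Mapping.keys (c * f)"
      then obtain s s' where t: "t = s + s'" "s' \<in> Poly_Mapping.keys f"
        using keys_mult[of c f] by blast
      then obtain g where g: "g \<in> I" "g \<noteq> 0" "initial_monomial prec g = s'"
        using 3 by blast
      then show "\<exists>g\<in>I. g \<noteq> 0 \<and> initial_monomial prec g = t"
        using ideal_scale[OF I, of g "Poly_Mapping.single s 1"] t
        by (intro bexI[of _ "Poly_Mapping.single s 1 * g"])
           (simp_all add: single_mult_nonzero initial_monomial_single_mult)
    qed
  qed simp
  then have "initial_ideal prec I \<subseteq> ?S"
    unfolding initial_ideal_def by (intro module.span_minimal[OF module_ring_mult]) auto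
  then show ?thesis
    using assms(2) unfolding standard_monomials_def by auto
qed

lemma initial_nonstandard:
  assumes "g \<in> I" "g \<noteq> 0"
  shows "initial_monomial prec g \<notin> standard_monomials prec I"
proof -
  have "Poly_Mapping.single (initial_monomial prec g) 1 \<in> initial_ideal prec I"
    unfolding initial_ideal_def
    by (rule module.span_base[OF module_ring_mult]) (use assms in blast)
  then show ?thesis
    by (simp add: standard_monomials_def)
qed

lemma standard_reduction:
  fixes I :: "('v, 'k::field) mpoly set"
  assumes I: "module.subspace (*) I"
  shows "\<exists>r\<in>standard_span prec I. f - r \<in> I"
proof -
  define Q where "Q f \<longleftrightarrow> (\<exists>r\<in>standard_span prec I. f - r \<in> I)" for f
  have Q_add: "Q (f + g)" if Q: "Q f" "Q g" for f g
  proof -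
    obtain r s where rs: "r \<in> standard_span prec I" "s \<in> standard_span prec I"
        "f - r \<in> I" "g - s \<in> I"
      using Q unfolding Q_def by blast
    then have "r + s \<in> standard_span prec I"
      unfolding standard_span_def using module.span_add[OF module_scale] by blast
    moreover have "f + g - (r + s) \<in> I"
      using ideal_add[OF I rs(3,4)] by (simp add: algebra_simps)
    ultimately show ?thesis
      unfolding Q_def by blast
  qed
  have Q_0: "Q 0"
    unfolding Q_def by (intro bexI[of _ 0]) (simp_all add: ideal_0[OF I] standard_span_iff)
  have Q_I: "Q g" if "g \<in> I" for g
    unfolding Q_def using that by (intro bexI[of _ 0]) (simp_all add: standard_span_iff)
  have Q_sum: "Q (\<Sum>i\<in>A. h i)" if "\<And>i. i \<in> A \<Longrightarrow> Q (h i)" "finite A" for A :: "'v monom set" and h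
    using that(2,1) by (induction A) (auto simp: Q_0 Q_add)
  have "\<forall>c. Q (Poly_Mapping.single t c)" for t
  proof (induction t rule: prec_induct)
    case (less t)
    show ?case
    proof
      fix c
      show "Q (Poly_Mapping.single t c)"
      proof (cases "t \<in> standard_monomials prec I")
        case True
        then show ?thesis
          unfolding Q_def
          by (intro bexI[of _ "Poly_Mapping.single t c"]) (simp_all add: ideal_0[OF I] standard_span_iff)
      next
        case False
        then obtain g where g: "g \<in> I" "g \<noteq> 0" "initial_monomial prec g = t"
          using nonstandard_initial[OF I] by blast
        define a where "a = Poly_Mapping.lookup g t"
        have "a \<noteq> 0"
          using initial_monomial_in_keys[OF g(2)] g(3) by (simp add: a_def in_keys_iff)
        define h where "h = Poly_Mapping.single t c - scale (c / a) g"
        have "s \<prec> t" if "s \<in> Poly_Mapping.keys h" for s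
        proof -
          have "Poly_Mapping.lookup h t = 0"
            using \<open>a \<noteq> 0\<close> by (simp add: h_def lookup_minus lookup_scale a_def)
          then have "s \<noteq> t"
            using that by (auto simp: in_keys_iff)
          then have "s \<in> Poly_Mapping.keys g"
            using that by (auto simp: in_keys_iff h_def lookup_minus lookup_scale lookup_single when_def)
          then show ?thesis
            using initial_monomial_greatest g(3) \<open>s \<noteq> t\<close> by blast
        qed
        then have "Q h"
          using less Q_sum[of "Poly_Mapping.keys h" "\<lambda>s. Poly_Mapping.single s (Poly_Mapping.lookup h s)"]
          by (simp flip: sum_singles)
        moreover have "scale (c / a) g \<in> I"
          unfolding scale_def by (rule ideal_scale[OF I g(1)])
        ultimately have "Q (h + scale (c / a) g)"
          using Q_add Q_I by blast
        then show ?thesis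
          by (simp add: h_def)
      qed
    qed
  qed
  then have "Q f"
    using Q_sum[of "Poly_Mapping.keys f" "\<lambda>s. Poly_Mapping.single s (Poly_Mapping.lookup f s)"]
    by (simp flip: sum_singles)
  then show ?thesis
    unfolding Q_def .
qed

text \<open>
  A polynomial in the span of the standard monomials has minimal degree in its class modulo \<open>I\<close>. Otherwise
  subtracting a representative of smaller degree would leave its initial monomial in
  place, and this standard monomial would be an initial monomial of \<open>I\<close>.
\<close>

lemma standard_degree_minimal:
  assumes "f \<in> standard_span prec I" "f - l \<in> I" "\<And>t. t \<in> Poly_Mapping.keys l \<Longrightarrow> mdeg t < e"
    and "t \<in> Poly_Mapping.keys f"
  shows "mdeg t < e"
proof (rule ccontr)
  assume t: "\<not> mdeg t < e"
  define t0 where "t0 = initial_monomial prec f"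
  have "f \<noteq> 0"
    using assms(4) by auto
  then have t0: "t0 \<in> Poly_Mapping.keys f" "e \<le> mdeg t0"
    using initial_monomial_in_keys[of f] mdeg_initial_monomial[of f] mdeg_le_tdeg[OF assms(4)] t
    unfolding t0_def by simp_all
  then have t0l: "Poly_Mapping.lookup l t0 = 0"
    using assms(3)[of t0] by (auto simp: in_keys_iff)
  then have t0g: "t0 \<in> Poly_Mapping.keys (f - l)"
    using t0 by (simp add: in_keys_iff lookup_minus)
  have "initial_monomial prec (f - l) = t0"
  proof (rule initial_monomial_eqI[OF t0g])
    fix s assume "s \<in> Poly_Mapping.keys (f - l)" "s \<noteq> t0"
    then consider "s \<in> Poly_Mapping.keys f" | "s \<in> Poly_Mapping.keys l"
      by (cases "Poly_Mapping.lookup f s = 0") (auto simp: in_keys_iff lookup_minus)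
    then show "s \<prec> t0"
    proof cases
      case 1
      then show ?thesis using initial_monomial_greatest \<open>s \<noteq> t0\<close> unfolding t0_def by blast
    next
      case 2
      then show ?thesis using assms(3)[of s] t0 prec_mdeg by simp
    qed
  qed
  moreover have "f - l \<noteq> 0"
    using t0g by (metis keys_zero empty_iff)
  ultimately have "t0 \<notin> standard_monomials prec I"
    using initial_nonstandard[OF assms(2)] by blast
  then show False
    using assms(1) t0 standard_span_iff by blast
qed

end

lemma vanishing_ideal_subspace: "module.subspace (*) (vanishing_ideal X)"
  by (rule ideal_subspaceI) (auto simp: vanishing_ideal_def eval_zero eval_add eval_mult)

lemma eval_prod: "eval_poly (\<Prod>i\<in>A. h i) x = (\<Prod>i\<in>A. eval_poly (h i) x)"
  by (induction A rule: infinite_finite_induct)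
     (simp_all add: eval_mult eval_const flip: single_one)

text \<open>
  Lagrange interpolation: for each \<open>q \<noteq> p\<close> take a linear factor in a coordinate in which \<open>q\<close> and \<open>p\<close> differ.
\<close>

lemma separating_poly:
  fixes p :: "'v::finite \<Rightarrow> 'k::field"
  assumes "finite X"
  shows "\<exists>g. eval_poly g p = 1 \<and> (\<forall>q\<in>X - {p}. eval_poly g q = 0)"
proof -
  have "\<forall>q. q \<noteq> p \<longrightarrow> (\<exists>v. q v \<noteq> p v)"
    by (simp add: fun_eq_iff)
  then obtain v where v: "\<And>q. q \<noteq> p \<Longrightarrow> q (v q) \<noteq> p (v q)"
    by metis
  define g where "g = (\<Prod>q\<in>X - {p}. mvar (v q) - mconst (q (v q)))"
  have "eval_poly g p \<noteq> 0"
    using assms v[symmetric] by (simp add: g_def eval_prod eval_diff eval_var[simplified] eval_const)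
  moreover have "eval_poly g q = 0" if "q \<in> X - {p}" for q
    unfolding g_def eval_prod using assms that
    by (intro prod_zero) (auto simp: eval_diff eval_var[simplified] eval_const)
  ultimately show ?thesis
    by (intro exI[of _ "scale (1 / eval_poly g p) g"]) (simp add: eval_scale)
qed

context graded_order
begin

lemma standard_indicator:
  fixes X :: "('v \<Rightarrow> 'k::field) set"
  assumes "finite X" "p \<in> X"
  defines "f \<equiv> standard_indicator prec X p"
  shows "f \<in> standard_span prec (vanishing_ideal X)" "eval_poly f p = 1"
    "q \<in> X \<Longrightarrow> q \<noteq> p \<Longrightarrow> eval_poly f q = 0"
proof -
  let ?Q = "\<lambda>f. f \<in> standard_span prec (vanishing_ideal X) \<and> eval_poly f p = 1
      \<and> (\<forall>q\<in>X - {p}. eval_poly f q = 0)"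
  obtain g where g: "eval_poly g p = 1" "\<forall>q\<in>X - {p}. eval_poly g q = 0"
    using separating_poly[OF assms(1)] by blast
  obtain r where r: "r \<in> standard_span prec (vanishing_ideal X)" "g - r \<in> vanishing_ideal X"
    using standard_reduction[OF vanishing_ideal_subspace] by blast
  then have "?Q r"
    using g assms(2) by (auto simp: vanishing_ideal_def eval_diff)
  moreover have "f1 = f2" if "?Q f1" "?Q f2" for f1 f2
  proof -
    have "f1 - f2 \<in> standard_span prec (vanishing_ideal X)"
      using that module.span_diff[OF module_scale] unfolding standard_span_def by blast
    moreover have "eval_poly f1 q = eval_poly f2 q" if "q \<in> X" for q
      using \<open>?Q f1\<close> \<open>?Q f2\<close> that by (cases "q = p") auto
    then have "f1 - f2 - 0 \<in> vanishing_ideal X"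
      by (simp add: vanishing_ideal_def eval_diff)
    ultimately have "Poly_Mapping.keys (f1 - f2) = {}"
      using standard_degree_minimal[of "f1 - f2" "vanishing_ideal X" 0 0]
      by (auto simp del: keys_eq_empty)
    then show ?thesis
      by simp
  qed
  ultimately have "\<exists>!f. ?Q f"
    by blast
  then have "?Q f"
    unfolding f_def standard_indicator_def by (rule theI')
  then show "f \<in> standard_span prec (vanishing_ideal X)" "eval_poly f p = 1"
    "q \<in> X \<Longrightarrow> q \<noteq> p \<Longrightarrow> eval_poly f q = 0"
    by auto
qed

lemma standard_indicator_degree_minimal:
  fixes X :: "('v \<Rightarrow> 'k::field) set"
  assumes "finite X" "p \<in> X" "eval_poly l p = 1" "\<And>q. q \<in> X \<Longrightarrow> q \<noteq> p \<Longrightarrow> eval_poly l q = 0"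
  shows "tdeg (standard_indicator prec X p) \<le> tdeg l"
proof -
  let ?f = "standard_indicator prec X p"
  note f = standard_indicator[OF assms(1,2)]
  have "?f \<noteq> 0"
    using f(2) by (auto simp: eval_zero)
  then obtain t where t: "t \<in> Poly_Mapping.keys ?f" "mdeg t = tdeg ?f"
    using tdeg_attained by blast
  have "eval_poly ?f q = eval_poly l q" if "q \<in> X" for q
    using f assms that by (cases "q = p") auto
  then have "?f - l \<in> vanishing_ideal X"
    by (simp add: vanishing_ideal_def eval_diff)
  then have "mdeg t < Suc (tdeg l)"
    using standard_degree_minimal[OF f(1), of l "Suc (tdeg l)" t] t(1) mdeg_le_tdeg[of _ l]
    by (auto simp: less_Suc_eq_le)
  then show ?thesis
    using t by simp
qed

end

section \<open>The affine Hilbert function and the v-numbers\<close>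

lemma tdeg_le_iff: "tdeg f \<le> d \<longleftrightarrow> (\<forall>t\<in>Poly_Mapping.keys f. mdeg t \<le> d)"
  by (auto simp: tdeg_def)

definition val_scale :: "'k::field \<Rightarrow> (('v \<Rightarrow> 'k) \<Rightarrow> 'k) \<Rightarrow> ('v \<Rightarrow> 'k) \<Rightarrow> 'k" where
  "val_scale c g = (\<lambda>x. c * g x)"

definition delta :: "'a \<Rightarrow> 'a \<Rightarrow> 'k::field" where
  "delta p = (\<lambda>x. if x = p then 1 else 0)"

definition supported :: "('v \<Rightarrow> 'k) set \<Rightarrow> (('v \<Rightarrow> 'k::field) \<Rightarrow> 'k) set" where
  "supported X = {g. \<forall>x. x \<notin> X \<longrightarrow> g x = 0}"

text \<open>
  Evaluation on \<open>X\<close>, extended by zero so that all the value functions lie in one vector space. Its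
  kernel is the vanishing ideal, so it identifies quotients by that ideal with spaces of functions.
\<close>

definition values_on :: "('v::finite \<Rightarrow> 'k::field) set \<Rightarrow> ('v, 'k) mpoly \<Rightarrow> ('v \<Rightarrow> 'k) \<Rightarrow> 'k" where
  "values_on X f = (\<lambda>x. if x \<in> X then eval_poly f x else 0)"

lemma vector_space_val_scale: "vector_space val_scale"
  by unfold_locales (auto simp: val_scale_def fun_eq_iff algebra_simps)

interpretation val: vector_space val_scale
  by (rule vector_space_val_scale)

lemma vector_space_scale: "vector_space (scale :: 'k::field \<Rightarrow> ('v, 'k) mpoly \<Rightarrow> _)"
  using module_iff_vector_space[of scale] module_scale by blast

interpretation pol: vector_space scale
  by (rule vector_space_scale)

lemma linear_values_on: "Vector_Spaces.linear scale val_scale (values_on X)"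
  by unfold_locales
     (auto simp: values_on_def val_scale_def fun_eq_iff eval_add eval_scale)

interpretation values_on: Vector_Spaces.linear scale val_scale "values_on X" for X
  by (rule linear_values_on)

lemma sum_delta:
  assumes "finite A"
  shows "(\<Sum>p\<in>A. val_scale (u p) (delta p)) x = (if x \<in> A then u x else 0)"
  using assms by (induction A) (auto simp: val_scale_def delta_def)

lemma inj_delta: "inj_on (delta :: 'a \<Rightarrow> 'a \<Rightarrow> 'k::field) A"
  by (rule inj_onI) (metis delta_def zero_neq_one)

lemma independent_delta: "val.independent (delta ` A)"
  unfolding val.dependent_explicit
proof clarify
  fix t u v assume t: "finite t" "t \<subseteq> delta ` A" and 0: "(\<Sum>v\<in>t. val_scale (u v) v) = 0" and v: "v \<in> t" "u v \<noteq> 0"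
  obtain S where S: "t = delta ` S" "finite S"
    using t by (metis finite_subset_image subset_image_iff)
  have "(\<Sum>p\<in>S. val_scale (u (delta p)) (delta p)) = 0"
    using 0 unfolding S(1) by (simp add: sum.reindex[OF inj_delta])
  then have "u (delta p) = 0" if "p \<in> S" for p
    using sum_delta[OF S(2), of "\<lambda>p. u (delta p)" p] that by simp
  then show False
    using v S by blast
qed

lemma supported_span:
  assumes "finite X"
  shows "supported X = val.span (delta ` X)"
proof
  show "supported X \<subseteq> val.span (delta ` X)"
  proof
    fix g assume "g \<in> supported X"
    then have "g = (\<Sum>p\<in>X. val_scale (g p) (delta p))"
      using sum_delta[OF assms, of g] by (auto simp: supported_def fun_eq_iff)
    also have "\<dots> \<in> val.span (delta ` X)"
      by (intro val.span_sum val.span_scale val.span_base) auto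
    finally show "g \<in> val.span (delta ` X)" .
  qed
  have "val.subspace (supported X)"
    by (rule val.subspaceI) (auto simp: supported_def val_scale_def)
  then show "val.span (delta ` X) \<subseteq> supported X"
    by (intro val.span_minimal) (auto simp: supported_def delta_def)
qed

lemma subspace_supported: "finite X \<Longrightarrow> val.subspace (supported X)"
  by (simp add: supported_span val.subspace_span)

lemma dim_supported: "finite X \<Longrightarrow> val.dim (supported X) = card X"
  by (simp add: supported_span val.dim_eq_card_independent[OF independent_delta] card_image[OF inj_delta])

lemma finite_dimensional_val:
  "finite_dimensional_vector_space val_scale (range (delta :: ('v::finite \<Rightarrow> 'k::{field,finite}) \<Rightarrow> _))"
proof (intro finite_dimensional_vector_space.intro vector_space_val_scale
      finite_dimensional_vector_space_axioms.intro)
  show "val.span (range (delta :: ('v \<Rightarrow> 'k) \<Rightarrow> _ \<Rightarrow> 'k)) = UNIV"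
    using supported_span[of "UNIV :: ('v \<Rightarrow> 'k) set"] by (simp add: supported_def)
qed (simp_all add: independent_delta)

lemma values_on_zero_iff: "values_on X f = 0 \<longleftrightarrow> f \<in> vanishing_ideal X"
  by (auto simp: values_on_def vanishing_ideal_def fun_eq_iff)

text \<open>
  Independence modulo the kernel of a linear map is independence of the images, where the family of images
  may have no repetition.
\<close>

lemma independent_mod_iff:
  "(\<forall>A c. finite A \<and> A \<subseteq> B \<and> (\<Sum>b\<in>A. scale (c b) b) \<in> vanishing_ideal X \<longrightarrow> (\<forall>b\<in>A. c b = 0))
    \<longleftrightarrow> inj_on (values_on X) B \<and> val.independent (values_on X ` B)" (is "?L \<longleftrightarrow> ?R")
proof
  assume L: ?L
  have inj: "inj_on (values_on X) B"
  proof (rule inj_onI, rule ccontr)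
    fix f g assume fg: "f \<in> B" "g \<in> B" "values_on X f = values_on X g" "f \<noteq> g"
    then have "f - g \<in> vanishing_ideal X"
      by (simp flip: values_on_zero_iff add: values_on.diff)
    moreover have "(\<Sum>b\<in>{f, g}. scale (if b = f then 1 else -1) b) = f - g"
      using fg(4) by simp
    ultimately show False
      using L[rule_format, of "{f, g}" "\<lambda>b. if b = f then 1 else -1" f] fg by simp
  qed
  moreover have "val.independent (values_on X ` B)"
    unfolding val.dependent_explicit
  proof clarify
    fix t u v assume t: "finite t" "t \<subseteq> values_on X ` B"
      and 0: "(\<Sum>v\<in>t. val_scale (u v) v) = 0" and v: "v \<in> t" "u v \<noteq> 0"
    obtain A where A: "A \<subseteq> B" "t = values_on X ` A" "finite A"
      using t by (metis finite_subset_image)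
    have "values_on X (\<Sum>b\<in>A. scale (u (values_on X b)) b) = 0"
      using 0 unfolding A(2) by (simp add: sum.reindex[OF inj_on_subset[OF inj A(1)]] values_on.sum values_on.scale)
    then have "\<forall>b\<in>A. u (values_on X b) = 0"
      using L[rule_format, of A "\<lambda>b. u (values_on X b)"] A unfolding values_on_zero_iff by blast
    then show False
      using v A by blast
  qed
  ultimately show ?R ..
next
  assume R: ?R
  show ?L
  proof clarify
    fix A c b assume A: "finite A" "A \<subseteq> B" "(\<Sum>b\<in>A. scale (c b) b) \<in> vanishing_ideal X" "b \<in> A"
    have inj: "inj_on (values_on X) A"
      using R A inj_on_subset by blast
    define u where "u v = c (inv_into A (values_on X) v)" for v
    have "(\<Sum>v\<in>values_on X ` A. val_scale (u v) v) = values_on X (\<Sum>b\<in>A. scale (c b) b)"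
      unfolding sum.reindex[OF inj] values_on.sum values_on.scale
      by (intro sum.cong refl) (simp add: u_def inj)
    also have "\<dots> = 0"
      using A by (simp add: values_on_zero_iff)
    finally have "u (values_on X b) = 0"
      using R A val.independentD[of "values_on X ` B" "values_on X ` A" u "values_on X b"] by blast
    then show "c b = 0"
      using A inj by (simp add: u_def)
  qed
qed

lemma basis_mod_iff:
  assumes V: "module.subspace scale V" and "B \<subseteq> V"
  shows "basis_mod V (vanishing_ideal X \<inter> V) B \<longleftrightarrow> inj_on (values_on X) B
    \<and> val.independent (values_on X ` B) \<and> val.span (values_on X ` B) = values_on X ` V"
proof -
  have in_V: "(\<Sum>b\<in>A. scale (c b) b) \<in> V" if "A \<subseteq> B" for A c
    using that \<open>B \<subseteq> V\<close> by (intro pol.subspace_sum[OF V] pol.subspace_scale[OF V]) blast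
  have span_V: "pol.span B \<subseteq> V"
    using \<open>B \<subseteq> V\<close> V by (rule pol.span_minimal)
  have "f - g \<in> vanishing_ideal X \<inter> V \<longleftrightarrow> values_on X f = values_on X g"
    if "f \<in> V" "g \<in> pol.span B" for f g
  proof -
    have "f - g \<in> V"
      using that span_V by (intro pol.subspace_diff[OF V]) auto
    then show ?thesis
      by (simp only: Int_iff values_on_zero_iff[symmetric] values_on.diff right_minus_eq simp_thms)
  qed
  then have "(\<forall>f\<in>V. \<exists>g\<in>pol.span B. f - g \<in> vanishing_ideal X \<inter> V)
      \<longleftrightarrow> (\<forall>f\<in>V. \<exists>g\<in>pol.span B. values_on X f = values_on X g)"
    by blast
  also have "\<dots> \<longleftrightarrow> values_on X ` pol.span B = values_on X ` V"
    using span_V by blast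
  finally have gen: "(\<forall>f\<in>V. \<exists>g\<in>pol.span B. f - g \<in> vanishing_ideal X \<inter> V)
      \<longleftrightarrow> val.span (values_on X ` B) = values_on X ` V"
    by (simp add: values_on.span_image)
  have "(\<forall>A c. finite A \<and> A \<subseteq> B \<and> (\<Sum>b\<in>A. scale (c b) b) \<in> vanishing_ideal X \<inter> V
        \<longrightarrow> (\<forall>b\<in>A. c b = 0))
      \<longleftrightarrow> inj_on (values_on X) B \<and> val.independent (values_on X ` B)"
    unfolding independent_mod_iff[symmetric] using in_V by blast
  then show ?thesis
    unfolding basis_mod_def gen by (simp only: \<open>B \<subseteq> V\<close> simp_thms conj_assoc)
qed

lemma quotient_dim_vanishing:
  assumes V: "module.subspace scale V"
  shows "quotient_dim V (vanishing_ideal X \<inter> V) = val.dim (values_on X ` V)"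
proof -
  let ?basis = "basis_mod V (vanishing_ideal X \<inter> V)"
  have "pol.span V = V"
    using pol.span_minimal[OF order_refl V] pol.span_superset by blast
  then have sub: "val.span (values_on X ` V) = values_on X ` V"
    using values_on.span_image[of X V] by metis
  obtain B' where B': "B' \<subseteq> values_on X ` V" "val.independent B'" "values_on X ` V \<subseteq> val.span B'"
    using val.maximal_independent_subset by blast
  define B where "B = inv_into V (values_on X) ` B'"
  have im: "values_on X ` B = B'"
    using B'(1) by (auto simp: B_def image_image f_inv_into_f subset_iff intro!: image_eqI)
  have "inj_on (values_on X) B"
    using B'(1) by (auto simp: B_def inj_on_def f_inv_into_f subset_iff)
  moreover have "B \<subseteq> V"
    using B'(1) by (auto simp: B_def inv_into_into subset_iff)
  moreover have "val.span B' = values_on X ` V"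
    using B' val.span_mono[OF B'(1)] sub by auto
  ultimately have "?basis B"
    using B'(2) by (simp add: basis_mod_iff[OF V] im)
  then have basis: "?basis (SOME B. ?basis B)"
    by (rule someI)
  have "card B = val.dim (values_on X ` V)" if "?basis B" for B
  proof -
    have "B \<subseteq> V"
      using that unfolding basis_mod_def by blast
    then have "inj_on (values_on X) B" "val.independent (values_on X ` B)"
        "val.span (values_on X ` B) = values_on X ` V"
      using that by (simp_all add: basis_mod_iff[OF V])
    then show ?thesis
      using val.dim_eq_card[of "values_on X ` B" "values_on X ` V"] by (simp add: sub card_image)
  qed
  then show ?thesis
    unfolding quotient_dim_def using basis by blast
qed

lemma subspace_polys_le: "module.subspace scale (polys_le d :: ('v::finite, 'k::field) mpoly set)"
proof (rule pol.subspaceI)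
  fix f g :: "('v, 'k) mpoly" assume "f \<in> polys_le d" "g \<in> polys_le d"
  then show "f + g \<in> polys_le d"
    using keys_add[of f g] by (auto simp: polys_le_def tdeg_le_iff)
next
  fix c :: 'k and f :: "('v, 'k) mpoly" assume "f \<in> polys_le d"
  then show "scale c f \<in> polys_le d"
    by (auto simp: polys_le_def tdeg_le_iff in_keys_iff lookup_scale)
qed (simp add: polys_le_def tdeg_def)

text \<open>
  The space of polynomials of degree at most \<open>d\<close> modulo \<open>I\<close> is isomorphic to its image under evaluation. So
  the affine Hilbert function takes the value \<open>card X\<close> exactly if every function on \<open>X\<close> is given by a
  polynomial of degree at most \<open>d\<close>.
\<close>

lemma affine_hilbert_full_iff:
  fixes X :: "('v::finite \<Rightarrow> 'k::{field,finite}) set"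
  shows "affine_hilbert (vanishing_ideal X) d = card X
    \<longleftrightarrow> supported X \<subseteq> values_on X ` polys_le d"
proof -
  interpret fin: finite_dimensional_vector_space val_scale "range (delta :: ('v \<Rightarrow> 'k) \<Rightarrow> _)"
    by (rule finite_dimensional_val)
  have sub: "values_on X ` polys_le d \<subseteq> supported X"
    by (auto simp: values_on_def supported_def)
  have "val.dim (values_on X ` polys_le d) = card X
      \<longleftrightarrow> values_on X ` polys_le d = supported X"
    using fin.subspace_dim_equal[OF values_on.subspace_image[OF subspace_polys_le] _ sub]
      dim_supported[of X] subspace_supported[of X] by fastforce
  then show ?thesis
    using sub unfolding affine_hilbert_def quotient_dim_vanishing[OF subspace_polys_le] by blast
qed

context graded_order
begin

text \<open>
  The indicators of the points span all functions on \<open>X\<close>, and the standard indicators are the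
  representatives of least degree.
\<close>

lemma affine_hilbert_full_degree:
  fixes X :: "('v \<Rightarrow> 'k::{field,finite}) set"
  shows "affine_hilbert (vanishing_ideal X) d = card X
    \<longleftrightarrow> (\<forall>p\<in>X. tdeg (standard_indicator prec X p) \<le> d)"
  unfolding affine_hilbert_full_iff
proof
  assume *: "supported X \<subseteq> values_on X ` polys_le d"
  show "\<forall>p\<in>X. tdeg (standard_indicator prec X p) \<le> d"
  proof
    fix p assume p: "p \<in> X"
    then have "delta p \<in> supported X"
      by (auto simp: delta_def supported_def)
    then obtain l where l: "l \<in> polys_le d" "delta p = values_on X l"
      using * by blast
    then have "eval_poly l q = delta p q" if "q \<in> X" for q
      using that by (simp add: values_on_def)
    then have "tdeg (standard_indicator prec X p) \<le> tdeg l"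
      using p by (intro standard_indicator_degree_minimal) (auto simp: delta_def)
    then show "tdeg (standard_indicator prec X p) \<le> d"
      using l(1) by (simp add: polys_le_def)
  qed
next
  assume *: "\<forall>p\<in>X. tdeg (standard_indicator prec X p) \<le> d"
  have "delta p \<in> values_on X ` polys_le d" if "p \<in> X" for p
  proof -
    have "values_on X (standard_indicator prec X p) = delta p"
    proof
      fix x show "values_on X (standard_indicator prec X p) x = delta p x"
        using standard_indicator[OF _ that] that
        by (cases "x = p"; cases "x \<in> X") (auto simp: values_on_def delta_def)
    qed
    then show ?thesis
      using * that by (auto simp: polys_le_def intro!: rev_image_eqI)
  qed
  then show "supported X \<subseteq> values_on X ` polys_le d"
    unfolding supported_span[OF finite]
    by (intro val.span_minimal values_on.subspace_image[OF subspace_polys_le]) blast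
qed

lemma hilbert_reg_eq:
  fixes X :: "('v \<Rightarrow> 'k::{field,finite}) set"
  assumes "X \<noteq> {}" "\<And>p. p \<in> X \<Longrightarrow> tdeg (standard_indicator prec X p) = r"
  shows "hilbert_reg X = r"
  unfolding hilbert_reg_def affine_hilbert_full_degree
  by (rule Least_equality) (use assms in \<open>auto dest: spec\<close>)

end

lemma colon_indicator:
  fixes X :: "('v::finite \<Rightarrow> 'k::field) set"
  assumes "p \<in> X" "eval_poly f p \<noteq> 0" "\<And>q. q \<in> X \<Longrightarrow> q \<noteq> p \<Longrightarrow> eval_poly f q = 0"
  shows "colon_ideal (vanishing_ideal X) f = vanishing_ideal {p}"
  using assms by (fastforce simp: colon_ideal_def vanishing_ideal_def eval_mult)

text \<open>
  If \<open>f\<close> did not vanish at a point \<open>q \<noteq> p\<close>, then an indicator of \<open>q\<close> would vanish at \<open>p\<close> without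
  lying in \<open>(I : f)\<close>. If \<open>f\<close> vanished at \<open>p\<close> as well, then \<open>(I : f)\<close> would be the whole ring.
\<close>

lemma indicator_of_colon:
  fixes X :: "('v::finite \<Rightarrow> 'k::field) set"
  assumes "finite X" "p \<in> X" "colon_ideal (vanishing_ideal X) f = vanishing_ideal {p}"
  shows "eval_poly f p \<noteq> 0" "q \<in> X \<Longrightarrow> q \<noteq> p \<Longrightarrow> eval_poly f q = 0"
proof -
  have zero: "eval_poly f q = 0" if q: "q \<in> X" "q \<noteq> p" for q
  proof -
    obtain g where g: "eval_poly g q = 1" "\<forall>r\<in>X - {q}. eval_poly g r = 0"
      using separating_poly[OF assms(1)] by blast
    then have "g \<in> colon_ideal (vanishing_ideal X) f"
      unfolding assms(3) using q assms(2) by (simp add: vanishing_ideal_def)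
    then show ?thesis
      using g(1) q by (auto simp: colon_ideal_def vanishing_ideal_def eval_mult)
  qed
  then show "q \<in> X \<Longrightarrow> q \<noteq> p \<Longrightarrow> eval_poly f q = 0" .
  show "eval_poly f p \<noteq> 0"
  proof
    assume "eval_poly f p = 0"
    then have "eval_poly f q = 0" if "q \<in> X" for q
      using zero that by (cases "q = p") auto
    then have "1 \<in> colon_ideal (vanishing_ideal X) f"
      by (simp add: colon_ideal_def vanishing_ideal_def)
    then show False
      using eval_const[of 1 p] by (simp only: assms(3)) (simp add: vanishing_ideal_def)
  qed
qed

context graded_order
begin

text \<open>
  The polynomials \<open>f\<close> with \<open>(I : f)\<close> equal to the ideal of \<open>p\<close> are the nonzero multiples of the
  indicators of \<open>p\<close>, among which the standard one has least degree.
\<close>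

lemma v_number_eq:
  fixes X :: "('v \<Rightarrow> 'k::field) set"
  assumes X: "finite X" "p \<in> X"
  shows "v_number (vanishing_ideal {p}) (vanishing_ideal X) = tdeg (standard_indicator prec X p)"
  unfolding v_number_def
proof (rule Least_equality)
  note f = standard_indicator[OF X]
  have "standard_indicator prec X p \<noteq> 0"
    using f(2) by (auto simp: eval_zero)
  moreover have "colon_ideal (vanishing_ideal X) (standard_indicator prec X p) = vanishing_ideal {p}"
    using f X by (intro colon_indicator) auto
  ultimately show "\<exists>f. f \<noteq> 0 \<and> tdeg f = tdeg (standard_indicator prec X p)
      \<and> colon_ideal (vanishing_ideal X) f = vanishing_ideal {p}"
    by blast
next
  fix d assume "\<exists>f. f \<noteq> 0 \<and> tdeg f = d \<and> colon_ideal (vanishing_ideal X) f = vanishing_ideal {p}"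
  then obtain f where f: "tdeg f = d" "colon_ideal (vanishing_ideal X) f = vanishing_ideal {p}"
    by blast
  note ev = indicator_of_colon[OF X f(2)]
  have "tdeg (standard_indicator prec X p) \<le> tdeg (scale (1 / eval_poly f p) f)"
    using ev by (intro standard_indicator_degree_minimal[OF X]) (auto simp: eval_scale)
  also have "\<dots> \<le> d"
    using f(1) pol.subspace_scale[OF subspace_polys_le, of f d] by (simp add: polys_le_def)
  finally show "tdeg (standard_indicator prec X p) \<le> d" .
qed

end

section \<open>Indicator functions in the socle\<close>

text \<open>
  An indicator \<open>f\<close> of \<open>p\<close> satisfies \<open>(t_v - p_v) f \<in> I\<close>. Homogenized, this reads \<open>t_v f^h - p_v u f^h \<in> I^h\<close>, so
  \<open>t_v\<close> annihilates \<open>f^h\<close> modulo \<open>I^h + (u)\<close>.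
\<close>

lemma homogenize_indicator_socle:
  fixes X :: "('v::finite \<Rightarrow> 'k::field) set"
  assumes "\<And>q. q \<in> X \<Longrightarrow> q \<noteq> p \<Longrightarrow> eval_poly f q = 0"
  shows "mvar (Some v) * homogenize f - mvar None * (mconst (p v) * homogenize f)
    \<in> homogenize_ideal (vanishing_ideal X)"
proof -
  have "mvar v * f - mconst (p v) * f \<in> vanishing_ideal X"
    using assms by (fastforce simp: vanishing_ideal_def eval_diff eval_mult eval_const eval_var[simplified])
  then show ?thesis
    unfolding homogenize_ideal_eq[OF vanishing_ideal_subspace] mem_Collect_eq
      dehom_diff dehom_mvar_Some dehom_mvar_None dehom_mconst dehom_homogenize
    by (auto simp: ideal_0[OF vanishing_ideal_subspace])
qed

context graded_order
begin

text \<open>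
  Modulo \<open>I^h + (u)\<close>, a homogenized polynomial remembers exactly its form of top degree modulo the top forms
  of \<open>I\<close>. For elements of the span of the standard monomials these top forms are already reduced. So a linear
  relation modulo \<open>I^h + (u)\<close> holds for the coefficients in top degree, degree by degree.
\<close>

lemma top_coefficients_dependent:
  fixes I :: "('v, 'k::field) mpoly set"
  assumes I: "module.subspace (*) I" and f: "f \<in> standard_span prec I" "f' \<in> standard_span prec I"
    and dep: "mconst \<alpha> * homogenize f + mconst \<beta> * homogenize f' - mvar None * g \<in> homogenize_ideal I"
  shows "\<alpha> * (if mdeg t = tdeg f then Poly_Mapping.lookup f t else 0)
    + \<beta> * (if mdeg t = tdeg f' then Poly_Mapping.lookup f' t else 0) = 0"
proof -
  define e where "e = mdeg t"
  define h where "h = scale \<alpha> (if e = tdeg f then f else 0) + scale \<beta> (if e = tdeg f' then f' else 0)"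
  \<comment> \<open>The multiple of \<open>u\<close> contributes only terms of degree less than \<open>e\<close>.\<close>
  define l where "l = (if e = 0 then 0 else dehom (e - 1) g)"
  have "h \<in> standard_span prec I"
    using f unfolding h_def standard_span_def
    by (auto intro!: pol.span_add pol.span_scale pol.span_zero)
  moreover have "h - l \<in> I"
    using dep unfolding homogenize_ideal_eq[OF I] mem_Collect_eq dehom_diff dehom_add
      dehom_mconst dehom_homogenize dehom_mvar_None
    by (auto simp: h_def l_def scale_def dest: spec[of _ e])
  moreover have "mdeg s < e" if "s \<in> Poly_Mapping.keys l" for s
    using that dehom_keys[of s "e - 1" g] by (auto simp: l_def split: if_splits)
  ultimately have "t \<notin> Poly_Mapping.keys h"
    using standard_degree_minimal[of h I l e t] by (auto simp: e_def)
  then show ?thesis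
    by (auto simp: in_keys_iff h_def lookup_add lookup_scale e_def)
qed

lemma dependent_imp_same_initial_monomial:
  fixes I :: "('v, 'k::field) mpoly set"
  assumes I: "module.subspace (*) I" and f: "f \<in> standard_span prec I" "f' \<in> standard_span prec I"
    and nz: "f \<noteq> 0" "f' \<noteq> 0" "(\<alpha>, \<beta>) \<noteq> (0, 0)"
    and dep: "mconst \<alpha> * homogenize f + mconst \<beta> * homogenize f' - mvar None * g \<in> homogenize_ideal I"
  shows "initial_monomial prec f = initial_monomial prec f'"
proof -
  note top = top_coefficients_dependent[OF I f dep]
  let ?t = "initial_monomial prec f" and ?t' = "initial_monomial prec f'"
  have t: "mdeg ?t = tdeg f" "Poly_Mapping.lookup f ?t \<noteq> 0"
      "mdeg ?t' = tdeg f'" "Poly_Mapping.lookup f' ?t' \<noteq> 0"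
    using nz initial_monomial_in_keys mdeg_initial_monomial by (auto simp: in_keys_iff)
  have "\<alpha> \<noteq> 0" "\<beta> \<noteq> 0"
    using top[of ?t] top[of ?t'] t nz(3) by auto
  then have "?t \<in> Poly_Mapping.keys f'" "?t' \<in> Poly_Mapping.keys f"
    using top[of ?t] top[of ?t'] t by (auto simp: in_keys_iff split: if_splits)
  then show ?thesis
    using initial_monomial_greatest prec_trans prec_irrefl by metis
qed

lemma homogenize_not_boundary:
  fixes I :: "('v, 'k::field) mpoly set"
  assumes I: "module.subspace (*) I" and f: "f \<in> standard_span prec I" "f \<noteq> 0"
  shows "homogenize f - mvar None * g \<notin> homogenize_ideal I"
proof
  assume "homogenize f - mvar None * g \<in> homogenize_ideal I"
  then have "mconst 1 * homogenize f + mconst 0 * homogenize f - mvar None * g \<in> homogenize_ideal I"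
    by simp
  from top_coefficients_dependent[OF I f(1) f(1) this, of "initial_monomial prec f"] show False
    using f(2) initial_monomial_in_keys[of f] mdeg_initial_monomial[of f] by (simp add: in_keys_iff)
qed

lemma gorenstein_same_initial_monomial:
  fixes X :: "('v \<Rightarrow> 'k::field) set"
  assumes X: "finite X" "p \<in> X" "q \<in> X" and gor: "gorenstein (vanishing_ideal X)"
  shows "initial_monomial prec (standard_indicator prec X p)
    = initial_monomial prec (standard_indicator prec X q)"
proof -
  let ?I = "vanishing_ideal X" and ?f = "standard_indicator prec X"
  obtain r b a M where res: "minimal_graded_free_resolution (homogenize_ideal ?I) r b a M" and "b r = 1"
    using gor unfolding gorenstein_def gorenstein_quotient_def by blast
  obtain vs :: "'v list" where vs: "set vs = UNIV" "distinct vs"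
    using finite_distinct_list[OF finite_UNIV] by blast
  interpret resolution "homogenize_ideal ?I" r b a M vs
  proof
    show "module.subspace (*) (homogenize_ideal ?I)"
      unfolding homogenize_ideal_def by (rule module.subspace_span[OF module_ring_mult])
  qed (use res vs homogenize_ideal_regular[OF vanishing_ideal_subspace] in auto)
  have socle: "homogenize (?f x) \<in> socle" if "x \<in> X" for x
    unfolding socle_def using homogenize_indicator_socle[OF standard_indicator(3)[OF X(1) that]] by blast
  have nz: "?f x \<noteq> 0" if "x \<in> X" for x
    using standard_indicator(2)[OF X(1) that] by (auto simp: eval_zero)
  have "\<nexists>g. homogenize (?f p) - mvar None * g \<in> homogenize_ideal ?I"
    using homogenize_not_boundary[OF vanishing_ideal_subspace standard_indicator(1)[OF X(1,2)] nz[OF X(2)]]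
    by blast
  then obtain \<alpha> \<beta> g where "(\<alpha>, \<beta>) \<noteq> (0, 0)"
      "mconst \<alpha> * homogenize (?f p) + mconst \<beta> * homogenize (?f q) - mvar None * g \<in> homogenize_ideal ?I"
    using socle_dependent[OF \<open>b r = 1\<close> socle[OF X(2)] _ socle[OF X(3)]] by blast
  then show ?thesis
    using dependent_imp_same_initial_monomial[OF vanishing_ideal_subspace
        standard_indicator(1)[OF X(1,2)] standard_indicator(1)[OF X(1,3)] nz[OF X(2)] nz[OF X(3)]]
    by blast
qed

end


theorem theorem6p11:
  fixes P :: "nat \<Rightarrow> ('n::finite \<Rightarrow> 'k::{field,finite})"
    and m :: nat
    and X :: "('n \<Rightarrow> 'k) set"
    and I :: "('n, 'k) mpoly set"
    and prec :: "'n monom \<Rightarrow> 'n monom \<Rightarrow> bool"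
    and f :: "nat \<Rightarrow> ('n, 'k) mpoly"
    and \<pp> :: "nat \<Rightarrow> ('n, 'k) mpoly set"
  assumes "m \<ge> 2"
    and "inj_on P {1..m}"
    and "X = P ` {1..m}"
    and "I = vanishing_ideal X"
    and "graded_monomial_order prec"
    and "\<And>i. i \<in> {1..m} \<Longrightarrow> f i = standard_indicator prec X (P i)"
    and "\<And>i. i \<in> {1..m} \<Longrightarrow> \<pp> i = vanishing_ideal {P i}"
    and "gorenstein I"
  shows "\<forall>i\<in>{1..m}. v_number (\<pp> i) I = tdeg (f i)
    \<and> tdeg (f i) = hilbert_reg X
    \<and> initial_monomial prec (f i) = initial_monomial prec (f m)"
proof
  fix i assume i: "i \<in> {1..m}"
  interpret graded_order prec
    by unfold_locales (rule assms(5))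
  have m: "m \<in> {1..m}"
    using assms(1) by simp
  have X: "P j \<in> X" if "j \<in> {1..m}" for j
    using that assms(3) by blast
  have same: "initial_monomial prec (standard_indicator prec X p) = initial_monomial prec (f m)"
    if "p \<in> X" for p
    using gorenstein_same_initial_monomial[OF finite that X[OF m]] assms(4,6,8) m by simp
  have deg: "tdeg (standard_indicator prec X p) = mdeg (initial_monomial prec (f m))" if "p \<in> X" for p
  proof -
    have "standard_indicator prec X p \<noteq> 0"
      using standard_indicator(2)[OF finite that] by (auto simp: eval_zero)
    then show ?thesis
      using mdeg_initial_monomial same[OF that] by metis
  qed
  have "hilbert_reg X = mdeg (initial_monomial prec (f m))"
    using deg X[OF m] by (intro hilbert_reg_eq) auto
  then show "v_number (\<pp> i) I = tdeg (f i) \<and> tdeg (f i) = hilbert_reg X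
      \<and> initial_monomial prec (f i) = initial_monomial prec (f m)"
    using v_number_eq[OF finite X[OF i]] deg[OF X[OF i]] same[OF X[OF i]] i
    by (simp add: assms(4,6,7))
qed

end
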